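(* Let $(\hat\pi_k)$ be a sequence of probability measures on $\mathbb{N}_0$ with $\sum_{j\ge0}j\hat\pi_k(j)=1$ for all $k$, let $(h_k)$, $(\tau_k)$ be two positive sequences that converge to $0$, and let $$\breve\mu_k=\frac1{\tau_k}\sum_{j\ge2}(j-1)\hat\pi_k(j)\,\delta_{jh_k},\qquad\eta_k=\sum_{j\ge-1}\hat\pi_k(j+1)\,\delta_{jh_k}.$$ Then the following are equivalent. (A) There exist $\hat a\in\mathbb{R}$, $\hat b\ge0$ and a positive $\sigma$-finite measure $F$ on $(0,\infty)$ such that, as $k\to\infty$, $$\int_{\mathbb{R}}\frac{x}{1+x^2}\,\frac{d\eta_k(x)}{h_k\tau_k}\to\hat a,\qquad\int_{\mathbb{R}}\frac{x^2}{1+x^2}\,\frac{d\eta_k(x)}{h_k\tau_k}\to\hat b,$$ and $$\int_{[x,\infty)}\frac{d\eta_k}{h_k\tau_k}\to F([x,\infty))\quad\text{for a.e. }x>0.$$ (B) There exists a finite measure $\kappa$ on $[0,\infty]$ such that $(\breve\mu_k)$ Lévy-converges to $\kappa$.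
   Context: $\mathbb{N}_0=\{0,1,2,\dots\}$; $\delta_x$ is the Dirac mass at $x$; $x\wedge 1=\min(x,1)$. Lévy-convergence: $(\breve\mu_k)$ Lévy-converges to a finite measure $\kappa$ on $[0,\infty]$ if $(x\wedge1)\,d\breve\mu_k(x)\to d\kappa(x)$ weak-$\star$ on $[0,\infty]$, i.e. when tested against every $g\in C([0,\infty])$. *)

theory Defs
  imports "HOL-Probability.Probability"
begin

text \<open>The Borel measure \<open>\<Sum>j\<in>I. w j \<cdot> \<delta>\<^bsub>x j\<^esub>\<close> on the real line, for nonnegative weights \<open>w\<close>.\<close>

definition point_masses :: "'i set \<Rightarrow> ('i \<Rightarrow> real) \<Rightarrow> ('i \<Rightarrow> real) \<Rightarrow> real measure" where
  "point_masses I w x = distr (density (count_space I) (\<lambda>j. ennreal (w j))) borel x"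

lemma emeasure_point_masses:
  assumes "A \<in> sets borel"
  shows "emeasure (point_masses I w x) A = (\<integral>\<^sup>+j. ennreal (w j) * indicator A (x j) \<partial>count_space I)"
proof -
  have "emeasure (point_masses I w x) A
      = (\<integral>\<^sup>+j. ennreal (w j) * indicator (x -` A \<inter> I) j \<partial>count_space I)"
    using assms by (simp add: point_masses_def emeasure_distr emeasure_density)
  also have "\<dots> = (\<integral>\<^sup>+j. ennreal (w j) * indicator A (x j) \<partial>count_space I)"
    by (rule nn_integral_cong) (simp add: indicator_def)
  finally show ?thesis .
qed

definition mu_breve :: "nat pmf \<Rightarrow> real \<Rightarrow> real \<Rightarrow> real measure" where
  "mu_breve p h \<tau> =
     point_masses {2..} (\<lambda>j::nat. 1 / \<tau> * ((real j - 1) * pmf p j)) (\<lambda>j. real j * h)"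

definition eta :: "nat pmf \<Rightarrow> real \<Rightarrow> real measure" where
  "eta p h = point_masses {-1..} (\<lambda>j::int. pmf p (nat (j + 1))) (\<lambda>j. real_of_int j * h)"

text \<open>The compact interval \<open>[0,\<infinity>]\<close> is the type \<^typ>\<open>ennreal\<close>; the measures \<open>M k\<close> are Borel measures
  on the real line that are carried by \<open>(0,\<infinity>)\<close> and satisfy \<open>\<integral> (x \<and> 1) dM k < \<infinity>\<close>, so that the
  integrals on the left are genuine.\<close>

definition levy_converges :: "(nat \<Rightarrow> real measure) \<Rightarrow> ennreal measure \<Rightarrow> bool" where
  "levy_converges M K \<longleftrightarrow>
     (\<forall>g :: ennreal \<Rightarrow> real. continuous_on UNIV g \<longrightarrow>
        (\<lambda>k. \<integral>x. g (ennreal x) * min x 1 \<partial>M k) \<longlonglongrightarrow> (\<integral>y. g y \<partial>K))"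

end

theory Submission
  imports Defs
begin

text \<open>
Write \<open>X = (j - 1) h\<close> and \<open>Y = X + h = j h\<close> for a random \<open>j\<close> with law \<open>p k\<close>. Then \<open>eta\<close> is the law
of \<open>X\<close>, and \<open>mu_breve\<close> puts at \<open>Y\<close> the mass of the offspring law times \<open>(j - 1) / \<tau> = X / (h \<tau>)\<close>.
Levy-convergence is the weak convergence on \<open>[0,\<infinity>]\<close> of the finite measures \<open>R k\<close> given by
\<open>(x \<and> 1) d mu_breve\<close>, and every condition in (A) can be read off from \<open>R k\<close>.

Since \<open>X\<close> has mean zero, the two truncated moments do not change when a multiple of \<open>X\<close> is added to
the integrand. Choosing the multiple so that the atom of \<open>eta\<close> at \<open>- h\<close> drops out gives the exact
identities of \<open>integral_eta_kernel\<close>: the moments are \<open>- \<integral> kernel_inf h dR\<close> and \<open>\<integral> kernel_zero h dR\<close>.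
As \<open>h \<rightarrow> 0\<close> the kernels converge uniformly (\<open>kernel_close\<close>) to continuous functions on \<open>[0,\<infinity>]\<close> with
end values \<open>(0, 1)\<close> and \<open>(1, 0)\<close>, whose sum is bounded below (\<open>kernel_sum_ge\<close>). Likewise the tails
of \<open>eta / (h \<tau>)\<close> are, up to a shift by \<open>h\<close> and a factor tending to 1, the tails of \<open>R k\<close> divided by
the weight \<open>y (y \<and> 1)\<close> (\<open>tail_comparison\<close>).

From (B) to (A), the limit kernels are test functions, and tails converge at every continuity point
of the limiting tail. From (A) to (B), the moments bound the masses of \<open>R k\<close>, the tails give
convergence on compact subsets of \<open>(0,\<infinity>)\<close> (\<open>vague_convergence_from_tails\<close>), and the two moments
determine how much mass escapes to 0 and to \<open>\<infinity>\<close>. These two masses are added to the limit on \<open>(0,\<infinity>)\<close>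
to form \<open>\<kappa>\<close> (\<open>measure_with_atoms_at_endpoints\<close>). Test functions vanishing at both ends are handled
by \<open>convergence_vanishing_at_ends\<close>, and every other one differs from such a function by a
combination of the two kernels.
\<close>

section \<open>Kernels of the truncated moments\<close>

text \<open>
The densities of the two truncated moments of \<open>eta\<close> against the measure \<open>(x \<and> 1) d mu_breve\<close>; the
variable \<open>y = x + h\<close> is the position of the atom of \<open>mu_breve\<close> belonging to the atom \<open>x\<close> of \<open>eta\<close>.
For \<open>h = 0\<close> they are \<open>y (y \<or> 1) / (1 + y\<^sup>2)\<close> and \<open>(y \<or> 1) / (1 + y\<^sup>2)\<close>, which extend continuously to
\<open>[0,\<infinity>]\<close>: the first is 0 at 0 and 1 at \<open>\<infinity>\<close>, the second is 1 at 0 and 0 at \<open>\<infinity>\<close>.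
\<close>

definition kernel_inf :: "real \<Rightarrow> real \<Rightarrow> real" where
  "kernel_inf h y = max y 1 * (y - 2 * h) / ((1 + (y - h)\<^sup>2) * (1 + h\<^sup>2))"

definition kernel_zero :: "real \<Rightarrow> real \<Rightarrow> real" where
  "kernel_zero h y = max y 1 * (1 + h * (y - h)) / ((1 + (y - h)\<^sup>2) * (1 + h\<^sup>2))"

text \<open>
Replacing the shifted kernels by their limits costs only \<open>O(h)\<close>, uniformly up to \<open>\<infinity>\<close>. The range
\<open>y \<ge> 2 h\<close> is where \<open>mu_breve\<close> has its atoms.
\<close>

lemma kernel_close:
  assumes "0 < h" "h \<le> 1" "2 * h \<le> y"
  shows "\<bar>kernel_inf h y - kernel_inf 0 y\<bar> \<le> 10 * h" and "\<bar>kernel_zero h y - kernel_zero 0 y\<bar> \<le> 10 * h"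
proof -
  define x where "x = y - h"
  define m where "m = max y 1"
  define P Q R where "P = 1 + x\<^sup>2" and "Q = 1 + h\<^sup>2" and "R = 1 + y\<^sup>2"
  have x: "x \<ge> h" "x > 0" "y = x + h" using assms by (auto simp: x_def)
  have m: "m \<ge> 1" "m \<ge> y" "m \<le> 1 + 2 * x" using assms by (auto simp: m_def x_def)
  have y: "y > 0" using assms by simp
  have m2: "m * y \<le> R" "m \<le> R"
    using y zero_le_power2[of "y - 1/2"]
    by (auto simp: m_def R_def max_def power2_eq_square algebra_simps)
  have pos: "P > 0" "Q > 0" "R > 0" by (auto simp: P_def Q_def R_def add_pos_nonneg)
  have ge1: "P \<ge> 1" "Q \<ge> 1" "R \<ge> 1" by (simp_all add: P_def Q_def R_def)
  have mP: "m \<le> 2 * P"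
    using m(3) zero_le_power2[of "x - 1/2"] zero_le_power2[of x]
        by (auto simp: P_def power2_eq_square algebra_simps)
  have xm: "x * m \<le> 3 * P"
  proof -
    have "x * m \<le> x * (1 + 2 * x)" using m x by (intro mult_left_mono) auto
    also have "\<dots> \<le> 3 * P" using zero_le_power2[of "x - 1/2"]
      by (auto simp: P_def power2_eq_square algebra_simps)
    finally show ?thesis .
  qed
  have x2: "2 * x \<le> P" "x\<^sup>2 \<le> P" using zero_le_power2[of "x - 1"]
      by (auto simp: P_def power2_eq_square algebra_simps)
  have hh: "h\<^sup>2 \<le> h" using assms by (simp add: power2_eq_square mult_left_le)
  have bound: "\<bar>N / (P * Q * R)\<bar> \<le> 10 * h" if "\<bar>N\<bar> \<le> 10 * h * (P * R)" for N
  proof -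
    have "\<bar>N\<bar> \<le> 10 * h * (P * R) * 1" using that by simp
    also have "\<dots> \<le> 10 * h * (P * R) * Q" using pos ge1 assms by (intro mult_left_mono) auto
    finally show ?thesis using pos by (simp add: abs_mult divide_le_eq mult_ac)
  qed
  have "m * R \<le> 2 * P * R" using mP pos by simp
  moreover have "(2 * x) * (m * y) \<le> P * R"
    using x2 m2 m y pos by (intro mult_mono) auto
  moreover have "x * m * R \<le> 3 * P * R" using xm pos by simp
  ultimately have *: "h * (m * R) \<le> h * (2 * P * R)" "h * ((2 * x) * (m * y)) \<le> h * (P * R)"
    "h * ((x * m) * R) \<le> h * (3 * P * R)"
    using assms by (auto intro: mult_left_mono)
  have "x\<^sup>2 * (m * y) \<le> P * R" "x\<^sup>2 * m \<le> P * R"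
    using x2 m2 m y pos by (auto intro!: mult_mono)
  then have **: "h\<^sup>2 * (x\<^sup>2 * (m * y)) \<le> h * (P * R)" "h\<^sup>2 * (x\<^sup>2 * m) \<le> h * (P * R)"
    using hh assms m y by (auto intro!: mult_mono simp del: mult_le_cancel_left)
  have "kernel_inf h y - kernel_inf 0 y
      = m * (- 2 * h * R + 2 * x * y * h - y * x\<^sup>2 * h\<^sup>2) / (P * Q * R)"
  proof -
    have "kernel_inf h y - kernel_inf 0 y = m * (x - h) / (P * Q) - m * y / R"
      by (simp add: kernel_inf_def m_def x_def P_def Q_def R_def)
    also have "\<dots> = m * ((x - h) * R - y * (P * Q)) / (P * Q * R)"
      using pos by (simp add: field_simps)
    also have "(x - h) * R - y * (P * Q) = - 2 * h * R + 2 * x * y * h - y * x\<^sup>2 * h\<^sup>2"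
      by (simp add: P_def Q_def R_def x(3) power2_eq_square algebra_simps)
    finally show ?thesis .
  qed
  moreover have "\<bar>m * (- 2 * h * R + 2 * x * y * h - y * x\<^sup>2 * h\<^sup>2)\<bar> \<le> 10 * h * (P * R)"
  proof -
    have nn: "h * (m * R) \<ge> 0" "h * ((2 * x) * (m * y)) \<ge> 0" "h\<^sup>2 * (x\<^sup>2 * (m * y)) \<ge> 0"
      using assms x y m pos by auto
    have "m * (- 2 * h * R + 2 * x * y * h - y * x\<^sup>2 * h\<^sup>2)
      = - 2 * (h * (m * R)) + h * ((2 * x) * (m * y)) - h\<^sup>2 * (x\<^sup>2 * (m * y))"
      by (simp add: algebra_simps)
    moreover have "h * (2 * P * R) = 2 * (h * (P * R))" "0 \<le> h * (P * R)" using assms pos by auto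
    ultimately show ?thesis using * ** nn by linarith
  qed
  ultimately show "\<bar>kernel_inf h y - kernel_inf 0 y\<bar> \<le> 10 * h" using bound by simp
  have "kernel_zero h y - kernel_zero 0 y = m * (3 * x * h + h * x * y\<^sup>2 - x\<^sup>2 * h\<^sup>2) / (P * Q * R)"
  proof -
    have "kernel_zero h y - kernel_zero 0 y = m * (1 + h * x) / (P * Q) - m * 1 / R"
      by (simp add: kernel_zero_def m_def x_def P_def Q_def R_def)
    also have "\<dots> = m * ((1 + h * x) * R - 1 * (P * Q)) / (P * Q * R)"
      using pos by (simp add: field_simps)
    also have "(1 + h * x) * R - 1 * (P * Q) = 3 * x * h + h * x * y\<^sup>2 - x\<^sup>2 * h\<^sup>2"
      by (simp add: P_def Q_def R_def x(3) power2_eq_square algebra_simps)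
    finally show ?thesis .
  qed
  moreover have "\<bar>m * (3 * x * h + h * x * y\<^sup>2 - x\<^sup>2 * h\<^sup>2)\<bar> \<le> 10 * h * (P * R)"
  proof -
    have nn: "h * ((x * m) * R) \<ge> 0" "h * (x * m) \<ge> 0" "h\<^sup>2 * (x\<^sup>2 * m) \<ge> 0"
      using assms x y m pos by auto
    have "h * (x * m) * 1 \<le> h * (x * m) * R" using nn ge1 by (intro mult_left_mono) auto
    then have "h * (x * m) \<le> h * ((x * m) * R)" by (simp add: mult_ac)
    moreover have "m * (3 * x * h + h * x * y\<^sup>2 - x\<^sup>2 * h\<^sup>2)
      = 2 * (h * (x * m)) + h * ((x * m) * R) - h\<^sup>2 * (x\<^sup>2 * m)"
      by (simp add: R_def algebra_simps)
    moreover have "h * (3 * P * R) = 3 * (h * (P * R))" "0 \<le> h * (P * R)" using assms pos by auto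
    ultimately show ?thesis using * ** nn by linarith
  qed
  ultimately show "\<bar>kernel_zero h y - kernel_zero 0 y\<bar> \<le> 10 * h" using bound by simp
qed

text \<open>
The two truncated moments together control the total mass of \<open>(x \<and> 1) d mu_breve\<close>, because the sum
of the two kernels stays away from 0. This is the source of compactness.
\<close>

lemma kernel_sum_ge:
  assumes "0 < h" "h \<le> 1 / 2" "2 * h \<le> y"
  shows "1 / 8 \<le> kernel_inf h y + kernel_zero h y"
proof -
  define x where "x = y - h"
  define m where "m = max y 1"
  have x: "x \<ge> h" "x > 0" using assms by (auto simp: x_def)
  have m: "m \<ge> 1" "m \<ge> x" using assms by (auto simp: m_def x_def)
  have h2: "h\<^sup>2 \<le> 1" using assms by (simp add: power_le_one)
  let ?D = "(1 + x\<^sup>2) * (1 + h\<^sup>2)"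
  have D: "?D > 0" by (simp add: add_pos_nonneg)
  have "?D \<le> (1 + x\<^sup>2) * 2" using h2 by (intro mult_left_mono) auto
  also have "\<dots> \<le> 8 * (m * (1/2 + x))"
  proof -
    have "1 * (1/2 + x) \<le> m * (1/2 + x)" "x * (1/2 + x) \<le> m * (1/2 + x)"
      using m x by (auto intro!: mult_right_mono)
    then show ?thesis using x by (simp add: power2_eq_square algebra_simps)
  qed
  also have "\<dots> \<le> 8 * (m * (1 + h * x + (x - h)))"
  proof -
    have "0 \<le> h * x" using assms x by simp
    then have "1 / 2 + x \<le> 1 + h * x + (x - h)" using assms by linarith
    then show ?thesis using m by (intro mult_left_mono) auto
  qed
  finally have "1 / 8 \<le> m * (1 + h * x + (x - h)) / ?D"
    using D by (simp add: field_simps)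
  also have "\<dots> = kernel_inf h y + kernel_zero h y"
    by (simp add: kernel_inf_def kernel_zero_def m_def x_def add_divide_distrib [symmetric] algebra_simps)
  finally show ?thesis .
qed

lemma kernel_bounded:
  assumes "0 \<le> y"
  shows "0 \<le> kernel_inf 0 y" "kernel_inf 0 y \<le> 1" "0 \<le> kernel_zero 0 y" "kernel_zero 0 y \<le> 2"
   "1/2 \<le> kernel_inf 0 y + kernel_zero 0 y"
proof -
  have R: "1 + y\<^sup>2 > 0" by (simp add: add_pos_nonneg)
  have inf: "kernel_inf 0 y = max y 1 * y / (1 + y\<^sup>2)" and zero: "kernel_zero 0 y = max y 1 / (1 + y\<^sup>2)"
    by (simp_all add: kernel_inf_def kernel_zero_def)
  show "0 \<le> kernel_inf 0 y" "0 \<le> kernel_zero 0 y" using assms R by (auto simp: inf zero)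
  have sq: "y \<le> 1 + y\<^sup>2" using zero_le_power2[of "y - 1/2"] by (auto simp: power2_eq_square algebra_simps)
  have sq1: "y * y \<le> 1" if "y \<le> 1" using that assms by (simp add: mult_le_one)
  have sq2: "1 \<le> y * y" if "1 \<le> y" using that mult_mono[of 1 y 1 y] by simp
  have "max y 1 * y \<le> 1 + y\<^sup>2" "max y 1 \<le> 2 * (1 + y\<^sup>2)" using sq by (auto simp: max_def power2_eq_square)
  then show "kernel_inf 0 y \<le> 1" "kernel_zero 0 y \<le> 2" using R by (auto simp: inf zero divide_le_eq)
  have "1 + y\<^sup>2 \<le> 2 * (max y 1 * y + max y 1)"
  proof (cases "y \<le> 1")
    case True
    then show ?thesis using sq1 assms by (simp add: max_def power2_eq_square)
  next
    case False
    then show ?thesis using sq2 assms by (simp add: max_def power2_eq_square)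
  qed
  then show "1/2 \<le> kernel_inf 0 y + kernel_zero 0 y"
    using R by (simp add: inf zero add_divide_distrib [symmetric] le_divide_eq)
qed

lemma kernel_limit_continuous: "continuous_on UNIV (kernel_inf 0)" "continuous_on UNIV (kernel_zero 0)"
   unfolding kernel_inf_def kernel_zero_def
   by (auto intro!: continuous_intros simp: add_nonneg_eq_0_iff)

lemma kernel_measurable [measurable]: "kernel_inf h \<in> borel_measurable borel" "kernel_zero h \<in>
    borel_measurable borel"
   unfolding kernel_inf_def [abs_def] kernel_zero_def [abs_def] by measurable

lemma kernel_limits: "kernel_inf 0 0 = 0" "kernel_zero 0 0 = 1"
   "(kernel_inf 0 \<longlongrightarrow> 1) at_top" "(kernel_zero 0 \<longlongrightarrow> 0) at_top"
proof -
  have lim: "((\<lambda>y::real. inverse y) \<longlongrightarrow> 0) at_top"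
    by (rule tendsto_inverse_0_at_top) (rule filterlim_ident)
  have est: "\<bar>kernel_inf 0 y - 1\<bar> \<le> inverse y \<and> \<bar>kernel_zero 0 y\<bar> \<le> inverse y" if "y \<ge> 1" for y
  proof -
    have R: "1 + y\<^sup>2 > 0" by (simp add: add_pos_nonneg)
    have "kernel_inf 0 y - 1 = - (1 / (1 + y\<^sup>2))"
      using that R by (simp add: kernel_inf_def max_def field_simps power2_eq_square)
    moreover have "kernel_zero 0 y = y / (1 + y\<^sup>2)" using that by (simp add: kernel_zero_def max_def)
    moreover have "y * 1 \<le> 1 + y * y" using that mult_left_mono[of 1 y y] by linarith
    moreover have "1 / (1 + y\<^sup>2) \<le> inverse y" "y / (1 + y\<^sup>2) \<le> inverse y"
      using that R calculation(3) by (simp_all add: field_simps power2_eq_square)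
    ultimately show ?thesis using that R by simp
  qed
  have "((\<lambda>y. kernel_inf 0 y - 1) \<longlongrightarrow> 0) at_top"
    by (rule tendsto_0_le[OF lim, where K = 1])
       (use est in \<open>auto intro!: eventually_at_top_linorderI[of 1]\<close>)
  from tendsto_add[OF this tendsto_const[of 1]] show "(kernel_inf 0 \<longlongrightarrow> 1) at_top" by simp
  show "(kernel_zero 0 \<longlongrightarrow> 0) at_top"
    by (rule tendsto_0_le[OF lim, where K = 1])
       (use est in \<open>auto intro!: eventually_at_top_linorderI[of 1]\<close>)
qed (simp_all add: kernel_inf_def kernel_zero_def)

section \<open>Monotone tails and vague convergence\<close>

text \<open>
Weak limits only determine tails up to moving the end point a little. For a monotone limit this
suffices at continuity points, and the same lemma absorbs the shift by \<open>h\<close> between \<open>eta\<close> and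
\<open>mu_breve\<close>.
\<close>

lemma antimono_squeeze:
  fixes f :: "nat \<Rightarrow> real \<Rightarrow> real" and T :: "real \<Rightarrow> real"
  assumes upper: "\<And>s e. 0 < s \<Longrightarrow> s < x \<Longrightarrow> e > 0 \<Longrightarrow> \<forall>\<^sub>F k in sequentially. f k x < T s + e"
    and lower: "\<And>t e. x < t \<Longrightarrow> e > 0 \<Longrightarrow> \<forall>\<^sub>F k in sequentially. T t - e < f k x"
    and x: "x > 0" and cont: "isCont T x"
  shows "(\<lambda>k. f k x) \<longlonglongrightarrow> T x"
proof (rule tendstoI)
  fix e :: real assume e: "e > 0"
  then have "e / 2 > 0" by simp
  with cont obtain d where d: "d > 0" "\<And>y. \<bar>y - x\<bar> < d \<Longrightarrow> \<bar>T y - T x\<bar> < e / 2"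
    unfolding continuous_at_eps_delta dist_real_def by blast
  define r where "r = min (d / 2) (x / 2)"
  have r: "r > 0" "r < d" "r < x" using d x by (auto simp: r_def)
  have "\<bar>T (x - r) - T x\<bar> < e / 2" "\<bar>T (x + r) - T x\<bar> < e / 2" using d r by auto
  note near = this
  have "\<forall>\<^sub>F k in sequentially. f k x < T (x - r) + e / 2"
    using r e by (intro upper) auto
  moreover have "\<forall>\<^sub>F k in sequentially. T (x + r) - e / 2 < f k x"
    using r e by (intro lower) auto
  ultimately show "\<forall>\<^sub>F k in sequentially. dist (f k x) (T x) < e"
  proof eventually_elim
    case (elim k)
    then show ?case using near unfolding dist_real_def by linarith
  qed
qed

lemma countable_discontinuities_antimono:
  fixes T :: "real \<Rightarrow> real"
  assumes "\<And>x y. 0 < x \<Longrightarrow> x \<le> y \<Longrightarrow> T y \<le> T x"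
  shows "countable {x. x > 0 \<and> \<not> isCont T x}"
proof -
  have "mono_on {0<..} (\<lambda>x. - T x)" using assms by (auto simp: mono_on_def)
  from mono_on_ctble_discont_open[OF _ this]
  have "countable {a \<in> {0<..}. \<not> isCont (\<lambda>x. - T x) a}" by simp
  moreover have "isCont (\<lambda>x. - T x) a \<longleftrightarrow> isCont T a" for a
    using isCont_minus[of a T] isCont_minus[of a "\<lambda>x. - T x"] by auto
  ultimately show ?thesis by (simp add: conj_commute)
qed

text \<open>
The test function is approximated by step functions on a grid \<open>c, 2 c, 3 c, \<dots>\<close>. Each multiple of \<open>c\<close>
lies in the exceptional set only for countably many \<open>c\<close>, so arbitrarily fine grids consist of points
at which the tails converge, and for step functions on such a grid convergence is a finite sum of
tail limits.
\<close>

lemma vague_convergence_from_tails: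
  fixes nu :: "nat \<Rightarrow> real measure" and V :: "real measure" and u :: "real \<Rightarrow> real"
  assumes sets_nu [measurable_cong, simp]:
      "\<And>k. sets (nu k) = sets borel" and sets_V [measurable_cong, simp]: "sets V = sets borel"
    and fin: "\<And>k x. 0 < x \<Longrightarrow> emeasure (nu k) {x..} < \<infinity>"
    and finV: "\<And>x. 0 < x \<Longrightarrow> emeasure V {x..} < \<infinity>"
    and N: "countable N"
    and tails: "\<And>x. 0 < x \<Longrightarrow> x \<notin> N \<Longrightarrow> (\<lambda>k. measure (nu k) {x..}) \<longlonglongrightarrow> measure V {x..}"
    and u: "continuous_on UNIV u" and supp: "0 < \<alpha>" "\<And>y. y \<notin> {\<alpha>..\<beta>} \<Longrightarrow> u y = 0"
  shows "(\<lambda>k. \<integral>y. u y \<partial>nu k) \<longlonglongrightarrow> (\<integral>y. u y \<partial>V)"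
proof (rule LIMSEQ_I)
  fix e :: real assume e: "e > 0"
  have [measurable]: "u \<in> borel_measurable borel" using u by (rule borel_measurable_continuous_onI)
  have ucont: "uniformly_continuous_on {0..\<beta>+\<alpha>} u"
    by (rule compact_uniformly_continuous[OF continuous_on_subset[OF u]]) auto
  obtain B where B: "\<And>y. \<bar>u y\<bar> \<le> B"
  proof -
    have "bounded (u ` {\<alpha>..\<beta>})"
      by (intro compact_imp_bounded compact_continuous_image continuous_on_subset[OF u]) auto
    then obtain B where "\<And>y. y \<in> {\<alpha>..\<beta>} \<Longrightarrow> \<bar>u y\<bar> \<le> B" unfolding bounded_iff real_norm_def by blast
    then have "\<bar>u y\<bar> \<le> max B 0" for y using supp(2)[of y] by (cases "y \<in> {\<alpha>..\<beta>}") force+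
    then show ?thesis using that by blast
  qed
  \<comment> \<open>The tail at \<open>a\<close>, just below the support, bounds the masses that the error acts on.\<close>
  obtain a where a: "0 < a" "a < \<alpha>" "a \<notin> N"
  proof -
    have "uncountable ({0<..<\<alpha>} - N)" using supp N
        by (intro uncountable_minus_countable) (auto simp: uncountable_open_interval)
    then have "{0<..<\<alpha>} - N \<noteq> {}" by (metis countable_empty)
    then obtain z where "z \<in> {0<..<\<alpha>} - N" by blast
    then show ?thesis using that[of z] by auto
  qed
  define C where "C = measure V {a..} + 1"
  have C: "C > 0" "measure V {a..} \<le> C" by (auto simp: C_def add_nonneg_pos)
  have evC: "\<forall>\<^sub>F k in sequentially. measure (nu k) {a..} < C"
    by (rule order_tendstoD[OF tails[OF a(1,3)]]) (simp add: C_def)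
  obtain d where d: "d > 0" "\<And>y z. y \<in> {0..\<beta>+\<alpha>} \<Longrightarrow> z \<in> {0..\<beta>+\<alpha>} \<Longrightarrow> \<bar>y - z\<bar> < d \<Longrightarrow> \<bar>u y - u z\<bar> < e / (4 * C)"
    using ucont[unfolded uniformly_continuous_on_def, rule_format, of "e / (4 * C)"] e C
    by (auto simp: dist_real_def abs_minus_commute)
  \<comment> \<open>As \<open>c < \<alpha>\<close>, the grid starts below the support, so no values of \<open>u\<close> are missed.\<close>
  obtain c where c: "0 < c" "c < d" "c < \<alpha> - a" "\<And>i::nat. 0 < i \<Longrightarrow> real i * c \<notin> N"
  proof -
    let ?E = "(\<Union>i\<in>{0<..}. (\<lambda>z. z / real i) ` N)"
    have "countable ?E" using N by auto
    then have "uncountable ({0<..<min d (\<alpha> - a)} - ?E)"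
      using d a by (intro uncountable_minus_countable) (auto simp: uncountable_open_interval)
    then have "{0<..<min d (\<alpha> - a)} - ?E \<noteq> {}" by (metis countable_empty)
    then obtain c where "c \<in> {0<..<min d (\<alpha> - a)} - ?E" by blast
    then have c: "0 < c" "c < d" "c < \<alpha> - a" "c \<notin> ?E" by simp_all
    have "real i * c \<notin> N" if "0 < i" for i :: nat
    proof
      assume "real i * c \<in> N"
      then have "(real i * c) / real i \<in> ?E" using that by blast
      then show False using c that by simp
    qed
    with c that show ?thesis by blast
  qed
  obtain n :: nat where n: "\<beta> / c < real n" using reals_Archimedean2 by blast
  define s where "s y = (\<Sum>i=1..n. u (real i * c) * indicator {real i * c..<real (Suc i) * c} y)" for y
  have s_eq: "s y = u (real i * c)" if "1 \<le> i" "i \<le> n" "real i * c \<le> y" "y < real (Suc i) * c" for i y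
  proof -
    have "indicator {real j * c..<real (Suc j) * c} y = (if j = i then 1 else 0 :: real)" for j
    proof (cases "j = i")
      case False
      then consider "Suc j \<le> i" | "Suc i \<le> j" by linarith
      then have "y \<notin> {real j * c..<real (Suc j) * c}"
      proof cases
        case 1
        then have "real (Suc j) * c \<le> real i * c" using c by (intro mult_right_mono) auto
        then show ?thesis using that by auto
      next
        case 2
        then have "real (Suc i) * c \<le> real j * c" using c by (intro mult_right_mono) auto
        then show ?thesis using that by auto
      qed
      with False show ?thesis by simp
    qed (use that in auto)
    then have "s y = (\<Sum>i'=1..n. if i' = i then u (real i' * c) else 0)"
      unfolding s_def by (intro sum.cong) auto
    then show ?thesis using that by (simp add: sum.delta)
  qed
  have close: "\<bar>u y - s y\<bar> \<le> e / (4 * C) * indicator {a..} y" for y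
  proof (cases "c \<le> y \<and> y < real (Suc n) * c")
    case True
    define i where "i = nat \<lfloor>y / c\<rfloor>"
    have yc: "y / c \<ge> 1" using True c by simp
    then have fl: "1 \<le> \<lfloor>y / c\<rfloor>" by linarith
    then have i1: "1 \<le> i" and ri: "real i = of_int \<lfloor>y / c\<rfloor>" unfolding i_def by linarith+
    have "real i \<le> y / c" "y / c < real (Suc i)" unfolding of_nat_Suc ri by linarith+
    then have iy: "real i * c \<le> y" "y < real (Suc i) * c"
      using c by (simp_all only: pos_le_divide_eq pos_divide_less_eq)
    have "real i * c < real (Suc n) * c" using iy True by linarith
    then have "real i < real (Suc n)" using c by simp
    then have ile: "i \<le> n" by simp
    have s: "s y = u (real i * c)" using s_eq i1 ile iy by blast
    have near: "\<bar>y - real i * c\<bar> < c" using iy by (simp add: algebra_simps)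
    show ?thesis
    proof (cases "y \<in> {\<alpha>..\<beta>+\<alpha>}")
      case True
      then have "\<bar>u y - u (real i * c)\<bar> < e / (4 * C)"
        using iy near c supp by (intro d(2)) (auto intro: order_trans)
      then show ?thesis using True a s by simp
    next
      case False
      then have uy: "u y = 0" using supp by auto
      show ?thesis
      proof (cases "y < \<alpha>")
        case True
        then have "u (real i * c) = 0" using iy supp by auto
        then show ?thesis using uy s e C by simp
      next
        case c2: False
        then have "real i * c > \<beta>" using False near c a by auto
        then have "u (real i * c) = 0" using supp by auto
        then show ?thesis using uy s e C by simp
      qed
    qed
  next
    case False
    have "s y = 0" unfolding s_def
    proof (intro sum.neutral ballI)
      fix i assume i: "i \<in> {1..n}"
      then have "1 * c \<le> real i * c" "real (Suc i) * c \<le> real (Suc n) * c" using c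
          by (auto intro!: mult_right_mono)
      then have "y \<notin> {real i * c..<real (Suc i) * c}" using False by auto
      then show "u (real i * c) * indicator {real i * c..<real (Suc i) * c} y = 0" by simp
    qed
    moreover have "u y = 0"
    proof -
      have "\<beta> < real n * c" using n c by (simp add: pos_divide_less_eq)
      also have "\<dots> \<le> real (Suc n) * c" using c by (intro mult_right_mono) auto
      finally have "y \<notin> {\<alpha>..\<beta>}" using False c a by auto
      then show ?thesis using supp by blast
    qed
    ultimately show ?thesis using e C by simp
  qed
  have gen: "\<bar>(\<integral>y. u y \<partial>M) - (\<Sum>i=1..n. u (real i * c) * (measure M {real i
      * c..} - measure M {real (Suc i) * c..}))\<bar>
      \<le> e / (4 * C) * measure M {a..}"
    if [measurable_cong, simp]: "sets M = sets borel" and finM: "\<And>x. 0 < x \<Longrightarrow> emeasure M {x..} < \<infinity>"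
        for M :: "real measure"
  proof -
    have iu: "integrable M u"
    proof (rule Bochner_Integration.integrable_bound)
      show "integrable M (\<lambda>y. B * indicator {a..} y)" using finM[OF a(1)]
          by (intro integrable_mult_right integrable_real_indicator) auto
      show "AE y in M. norm (u y) \<le> norm (B * indicator {a..} y)"
      proof (rule AE_I2)
        fix y show "norm (u y) \<le> norm (B * indicator {a..} y)"
          using B[of y] supp(2)[of y] a by (cases "y \<ge> a") auto
      qed
    qed measurable
    have fin1: "{real i * c..<real (Suc i) * c} \<in> sets M" "emeasure M {real i * c..<real (Suc i)
        * c} < \<infinity>" if "1 \<le> i" for i
    proof -
      show "{real i * c..<real (Suc i) * c} \<in> sets M" by simp
      have "emeasure M {real i * c..<real (Suc i) * c} \<le> emeasure M {real i * c..}"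
          by (intro emeasure_mono) auto
      also have "\<dots> < \<infinity>" using that c by (intro finM) auto
      finally show "emeasure M {real i * c..<real (Suc i) * c} < \<infinity>" .
    qed
    have meas1: "measure M {real i * c..<real (Suc i) * c}
        = measure M {real i * c..} - measure M {real (Suc i) * c..}" if "1 \<le> i" for i
    proof -
      have "{real i * c..<real (Suc i) * c} = {real i * c..} - {real (Suc i) * c..}" by auto
      moreover have "{real (Suc i) * c..} \<subseteq> {real i * c..}" using c by (auto simp: algebra_simps)
      moreover have "emeasure M {real i * c..} \<noteq> \<infinity>" using finM[of "real i * c"] that c by auto
      ultimately show ?thesis by (simp add: measure_Diff)
    qed
    have si: "integrable M s" unfolding s_def
      by (intro Bochner_Integration.integrable_sum integrable_mult_right integrable_real_indicator fin1)
          auto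
    have "(\<integral>y. s y \<partial>M) = (\<Sum>i=1..n. u (real i * c) * measure M {real i * c..<real (Suc i) * c})"
      unfolding s_def
      by (subst Bochner_Integration.integral_sum)
         (auto intro!: integrable_mult_right integrable_real_indicator fin1 simp del: of_nat_Suc)
    then have ints: "(\<integral>y. s y \<partial>M)
        = (\<Sum>i=1..n. u (real i * c) * (measure M {real i * c..} - measure M {real (Suc i) * c..}))"
      using meas1 by simp
    have "\<bar>(\<integral>y. u y \<partial>M) - (\<integral>y. s y \<partial>M)\<bar> = \<bar>\<integral>y. u y - s y \<partial>M\<bar>"
      using iu si by simp
    also have "\<dots> \<le> (\<integral>y. \<bar>u y - s y\<bar> \<partial>M)" by (rule integral_abs_bound)
    also have "\<dots> \<le> (\<integral>y. e / (4 * C) * indicator {a..} y \<partial>M)"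
      using close iu si finM[OF a(1)] by (intro integral_mono) auto
    also have "\<dots> = e / (4 * C) * measure M {a..}" by simp
    finally show ?thesis using ints by simp
  qed
  let ?S = "\<lambda>M. (\<Sum>i=1..n. u (real i * c) * (measure M {real i * c..} - measure M {real (Suc i) * c..}))"
  have "(\<lambda>k. ?S (nu k)) \<longlonglongrightarrow> ?S V"
    using c by (intro tendsto_intros tails) (auto simp del: of_nat_Suc)
  from LIMSEQ_D[OF this, of "e / 4"] e obtain k0 where k0: "\<And>k. k \<ge> k0 \<Longrightarrow> \<bar>?S (nu k) - ?S V\<bar> < e / 4" by auto
  from evC obtain k1 where k1: "\<And>k. k \<ge> k1 \<Longrightarrow> measure (nu k) {a..} < C"
      by (auto simp: eventually_sequentially)
  have mul: "e / (4 * C) * z \<le> e / 4" if "z \<le> C" for z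
    using that e C mult_left_mono[of z C "e / (4 * C)"] by simp
  show "\<exists>no. \<forall>k\<ge>no. norm ((\<integral>y. u y \<partial>nu k) - (\<integral>y. u y \<partial>V)) < e"
  proof (intro exI allI impI)
    fix k assume "k \<ge> max k0 k1"
    then have k: "k \<ge> k0" "k \<ge> k1" by auto
    have "\<bar>(\<integral>y. u y \<partial>nu k) - ?S (nu k)\<bar> \<le> e / 4"
    proof (rule order_trans)
      show "\<bar>(\<integral>y. u y \<partial>nu k) - ?S (nu k)\<bar> \<le> e / (4 * C) * measure (nu k) {a..}"
        by (rule gen) (simp_all add: fin[unfolded infinity_ennreal_def])
      show "e / (4 * C) * measure (nu k) {a..} \<le> e / 4" using k1[OF k(2)] by (intro mul) simp
    qed
    moreover have "\<bar>(\<integral>y. u y \<partial>V) - ?S V\<bar> \<le> e / 4"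
    proof (rule order_trans)
      show "\<bar>(\<integral>y. u y \<partial>V) - ?S V\<bar> \<le> e / (4 * C) * measure V {a..}"
        by (rule gen) (simp_all add: finV[unfolded infinity_ennreal_def])
      show "e / (4 * C) * measure V {a..} \<le> e / 4" using C by (intro mul) simp
    qed
    ultimately show "norm ((\<integral>y. u y \<partial>nu k) - (\<integral>y. u y \<partial>V)) < e" using k0[OF k(1)] e
      unfolding real_norm_def by linarith
  qed
qed

section \<open>The compact interval of extended nonnegative reals\<close>

text \<open>
Test functions on \<open>[0,\<infinity>]\<close> are described by functions on the real line with a limit at infinity.
\<close>

lemma ennreal_extension_continuous:
  fixes f :: "real \<Rightarrow> real"
  assumes f: "continuous_on UNIV f" and L: "(f \<longlongrightarrow> L) at_top"
  shows "continuous_on UNIV (\<lambda>z::ennreal. if z = \<infinity> then L else f (enn2real z))"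
proof -
  let ?g = "\<lambda>z::ennreal. if z = \<infinity> then L else f (enn2real z)"
  have "isCont ?g z" for z
  proof (cases "z = \<infinity>")
    case False
    have "(enn2real \<longlongrightarrow> enn2real z) (at z)"
      using False by (intro tendsto_enn2real) (auto simp: less_top[symmetric] intro: tendsto_ident_at)
    moreover have "isCont f (enn2real z)" using f by (simp add: continuous_on_eq_continuous_at)
    ultimately have "((\<lambda>z. f (enn2real z)) \<longlongrightarrow> f (enn2real z)) (at z)"
        by (rule isCont_tendsto_compose[rotated])
    moreover have "\<forall>\<^sub>F y in at z. f (enn2real y) = ?g y"
    proof -
      have "open (- {\<infinity>::ennreal})" by (rule open_Compl) simp
      then show ?thesis using False eventually_at_topological[of _ z UNIV]
          by (auto intro!: exI[of _ "- {\<infinity>}"])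
    qed
    ultimately have "(?g \<longlongrightarrow> f (enn2real z)) (at z)" by (rule Lim_transform_eventually)
    then show ?thesis using False by (simp add: isCont_def)
  next
    case True
    have "(?g \<longlongrightarrow> L) (at \<infinity>)"
    proof (rule tendstoI)
      fix e :: real assume "e > 0"
      from tendstoD[OF L this] obtain B where B: "\<And>y. y \<ge> B \<Longrightarrow> dist (f y) L < e"
        by (auto simp: eventually_at_top_linorder)
      have "dist (?g y) L < e" if "y \<in> {ennreal B<..}" "y \<noteq> \<infinity>" for y
      proof -
        have "B \<le> enn2real y"
        proof (cases y)
          case (real r)
          then have "ennreal B < ennreal r" using that by simp
          then have "B \<le> r" by (meson ennreal_leI linorder_not_less nle_le)
          then show ?thesis using real by simp
        qed (use that in simp)
        then show ?thesis using B that by simp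
      qed
      then show "\<forall>\<^sub>F y in at \<infinity>. dist (?g y) L < e"
        by (subst eventually_at_topological) (auto intro!: exI[of _ "{ennreal B<..}"]
            simp: less_top[symmetric])
    qed
    then show ?thesis using True by (simp add: isCont_def)
  qed
  then show ?thesis by (simp add: continuous_on_eq_continuous_at)
qed

lemma continuous_ennreal_real:
  fixes g :: "ennreal \<Rightarrow> real"
  assumes g: "continuous_on UNIV g"
  shows "continuous_on UNIV (\<lambda>y. g (ennreal y))" and "((\<lambda>y. g (ennreal y)) \<longlongrightarrow> g \<infinity>) at_top"
proof -
  show "continuous_on UNIV (\<lambda>y. g (ennreal y))"
    by (rule continuous_on_compose2[OF g]) (auto intro!: continuous_on_ennreal continuous_intros)
  have "(ennreal \<longlongrightarrow> \<infinity>) at_top"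
    using ennreal_tendsto_top_eq_at_top[of "\<lambda>x. x" at_top] by (simp add: filterlim_ident)
  moreover have "isCont g \<infinity>" using g by (simp add: continuous_on_eq_continuous_at)
  ultimately show "((\<lambda>y. g (ennreal y)) \<longlongrightarrow> g \<infinity>) at_top" by (rule isCont_tendsto_compose[rotated])
qed

text \<open>
A finite measure on the line, transported to \<open>[0,\<infinity>]\<close> and completed by prescribed masses at the two
end points. The sum is built as a set function, and the integral formula follows for nonnegative
functions by the standard induction and for bounded continuous \<open>g\<close> by splitting into positive and
negative part.
\<close>

lemma measure_with_atoms_at_endpoints:
  fixes N :: "real measure"
  assumes N [measurable_cong, simp]: "sets N = sets borel" "finite_measure N" and ab: "0 \<le> \<alpha>" "0 \<le> \<beta>"
  obtains K :: "ennreal measure" where "sets K = sets borel" "finite_measure K"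
    "\<And>g :: ennreal \<Rightarrow> real. continuous_on UNIV g \<Longrightarrow>
       (\<integral>z. g z \<partial>K) = (\<integral>y. g (ennreal y) \<partial>N) + \<alpha> * g 0 + \<beta> * g \<infinity>"
proof -
  interpret N: finite_measure N by fact
  define m where "m A = emeasure N (ennreal -` A) + ennreal \<alpha> * indicator A 0
      + ennreal \<beta> * indicator A \<infinity>" for A :: "ennreal set"
  define K where "K = measure_of UNIV (sets borel) m"
  have sK [measurable_cong, simp]: "sets K = sets borel" and spK [simp]: "space K = UNIV"
    by (simp_all add: K_def) (metis sets.sigma_sets_eq space_borel)
  have vim: "ennreal -` A \<in> sets N" if "A \<in> sets borel" for A
    using measurable_sets[OF measurable_ennreal that] by simp
  have emK: "emeasure K A = m A" if "A \<in> sets borel" for A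
  proof (rule emeasure_measure_of[OF K_def])
    show "positive (sets K) m" by (simp add: positive_def m_def)
    show "countably_additive (sets K) m"
    proof (rule countably_additiveI)
      fix A :: "nat \<Rightarrow> ennreal set" assume A: "range A \<subseteq> sets K" "disjoint_family A"
      have "(\<Sum>i. emeasure N (ennreal -` A i)) = emeasure N (\<Union>i. ennreal -` A i)"
        using A vim by (intro suminf_emeasure) (auto simp: disjoint_family_on_def)
      moreover have "(\<Sum>i. c * indicator (A i) z) = c * indicator (\<Union>i. A i) z" for z and c :: ennreal
        using A suminf_indicator[of A z] by simp
      ultimately show "(\<Sum>i. m (A i)) = m (\<Union>i. A i)"
        by (simp add: m_def suminf_add[symmetric] vimage_UN)
    qed
  qed (use that in auto)
  have finK: "finite_measure K"
    by standard (simp add: emK m_def ennreal_add_eq_top ennreal_mult_eq_top_iff N.emeasure_finite)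
  have nn: "(\<integral>\<^sup>+z. f z \<partial>K) = (\<integral>\<^sup>+y. f (ennreal y) \<partial>N) + ennreal \<alpha> * f 0 + ennreal \<beta> * f \<infinity>"
    if "f \<in> borel_measurable K" for f
    using that
  proof (induction rule: borel_measurable_induct)
    case (cong f g)
    then have "f = g" by (auto simp: fun_eq_iff)
    then show ?case using cong by simp
  next
    case (set A)
    then have A: "A \<in> sets borel" by simp
    have "(\<integral>\<^sup>+y. indicator A (ennreal y) \<partial>N) = (\<integral>\<^sup>+y. indicator (ennreal -` A) y \<partial>N)"
      by (rule nn_integral_cong) (simp add: indicator_def)
    also have "\<dots> = emeasure N (ennreal -` A)" using vim[OF A] by simp
    finally show ?case using A by (simp add: emK m_def)
  next
    case (mult u c)
    then have [measurable]: "u \<in> borel_measurable borel" by simp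
    show ?case using mult by (simp add: nn_integral_cmult distrib_left mult_ac)
  next
    case (add u v)
    then have [measurable]: "u \<in> borel_measurable borel" "v \<in> borel_measurable borel" by simp_all
    show ?case using add by (simp add: nn_integral_add distrib_left add_ac)
  next
    case (seq U)
    then have [measurable]: "\<And>i. U i \<in> borel_measurable borel" by simp
    have inc: "incseq (\<lambda>i. U i z)" for z using seq by (auto simp: incseq_def le_fun_def)
    have lim: "(\<lambda>i. U i z) \<longlonglongrightarrow> (SUP i. U i) z" for z
      using LIMSEQ_SUP[OF inc[of z]] by (simp add: Sup_fun_def image_image)
    have "(\<lambda>i. \<integral>\<^sup>+z. U i z \<partial>K) \<longlonglongrightarrow> (\<integral>\<^sup>+z. (SUP i. U i) z \<partial>K)"
      using seq lim by (intro nn_integral_LIMSEQ) auto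
    moreover have "(\<lambda>i. \<integral>\<^sup>+y. U i (ennreal y) \<partial>N) \<longlonglongrightarrow> (\<integral>\<^sup>+y. (SUP i. U i) (ennreal y) \<partial>N)"
      using seq lim by (intro nn_integral_LIMSEQ) (auto simp: incseq_def le_fun_def)
    then have "(\<lambda>i. (\<integral>\<^sup>+y. U i (ennreal y) \<partial>N) + ennreal \<alpha> * U i 0 + ennreal \<beta> * U i \<infinity>)
        \<longlonglongrightarrow> (\<integral>\<^sup>+y. (SUP i. U i) (ennreal y) \<partial>N) + ennreal \<alpha> * (SUP i. U i) 0 + ennreal \<beta> * (SUP i. U i) \<infinity>"
      by (intro tendsto_add ennreal_tendsto_cmult lim) auto
    ultimately show ?case using seq by (intro LIMSEQ_unique) auto
  qed
  have int: "(\<integral>z. g z \<partial>K) = (\<integral>y. g (ennreal y) \<partial>N) + \<alpha> * g 0 + \<beta> * g \<infinity>"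
    if g: "continuous_on UNIV g" for g :: "ennreal \<Rightarrow> real"
  proof -
    have [measurable]: "g \<in> borel_measurable borel" using g by (rule borel_measurable_continuous_onI)
    have "bounded (range g)"
      by (intro compact_imp_bounded compact_continuous_image g compact_UNIV)
    then obtain B where B: "\<And>z. \<bar>g z\<bar> \<le> B" by (auto simp: bounded_iff)
    interpret K: finite_measure K by fact
    have iK: "integrable K g" and iN: "integrable N (\<lambda>y. g (ennreal y))"
      using B by (auto intro!: K.integrable_const_bound[where B = B] N.integrable_const_bound[where B = B])
    have fin: "(\<integral>\<^sup>+y. ennreal (s * g (ennreal y)) \<partial>N) < \<infinity>" if "\<bar>s\<bar> = 1" for s
    proof -
      have "(\<integral>\<^sup>+y. ennreal (s * g (ennreal y)) \<partial>N) \<le> (\<integral>\<^sup>+y. ennreal B \<partial>N)"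
        using B that by (intro nn_integral_mono ennreal_leI) (metis abs_le_D1 abs_mult mult_1)
      also have "\<dots> < \<infinity>" by (auto simp: ennreal_mult_eq_top_iff N.emeasure_finite less_top[symmetric])
      finally show ?thesis .
    qed
    have eq: "enn2real (\<integral>\<^sup>+z. ennreal (s * g z) \<partial>K)
      = enn2real (\<integral>\<^sup>+y. ennreal (s * g (ennreal y)) \<partial>N) + \<alpha> * max 0 (s * g 0) + \<beta> * max 0 (s * g \<infinity>)"
      if "\<bar>s\<bar> = 1" for s
      using ab fin[OF that]
      by (subst nn) (auto simp: enn2real_plus enn2real_mult ennreal_mult_less_top ennreal_add_eq_top
          max_def enn2real_eq_0_iff ennreal_neg less_top[symmetric] ennreal_mult_eq_top_iff)
    show ?thesis
      using eq[of 1] eq[of "-1"] iK iN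
      by (simp add: real_lebesgue_integral_def algebra_simps max_def split: if_splits)
  qed
  show ?thesis using that[OF sK finK int] .
qed

section \<open>Offspring laws and their rescaled measures\<close>

text \<open>
Both families of point masses are image measures under the offspring law, so that all integrals
become expectations over \<open>p\<close>. The density \<open>(j - 1) / \<tau>\<close> of \<open>mu_breve\<close> vanishes at \<open>j = 0\<close> and
\<open>j = 1\<close>, since \<open>ennreal\<close> sends negative numbers to 0; this encodes the restriction to \<open>j \<ge> 2\<close>.
\<close>

lemma eta_eq_distr: "eta p h = distr (measure_pmf p) borel (\<lambda>j. (real j - 1) * h)"
proof (rule measure_eqI)
  show "sets (eta p h) = sets (distr (measure_pmf p) borel (\<lambda>j. (real j - 1) * h))"
    by (simp add: eta_def point_masses_def)
  fix A assume "A \<in> sets (eta p h)"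
  then have A: "A \<in> sets borel" by (simp add: eta_def point_masses_def)
  have bij: "bij_betw (\<lambda>j. int j - 1) UNIV {-1..}"
    by (rule bij_betw_byWitness[where f' = "\<lambda>i. nat (i + 1)"]) auto
  have "emeasure (eta p h) A
      = (\<integral>\<^sup>+j. ennreal (pmf p (nat (j + 1))) * indicator A (real_of_int j * h) \<partial>count_space {-1..})"
    unfolding eta_def by (rule emeasure_point_masses[OF A])
  also have "\<dots> = (\<integral>\<^sup>+j. ennreal (pmf p j) * indicator A ((real j - 1) * h) \<partial>count_space UNIV)"
    by (subst nn_integral_bij_count_space[OF bij, symmetric]) simp
  also have "\<dots> = (\<integral>\<^sup>+j. indicator A ((real j - 1) * h) \<partial>measure_pmf p)"
    by (simp add: nn_integral_measure_pmf)
  also have "\<dots> = (\<integral>\<^sup>+j. indicator ((\<lambda>j. (real j - 1) * h) -` A) j \<partial>measure_pmf p)"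
    by (rule nn_integral_cong) (simp add: indicator_def)
  also have "\<dots> = emeasure (distr (measure_pmf p) borel (\<lambda>j. (real j - 1) * h)) A"
    using A by (simp add: emeasure_distr)
  finally show "emeasure (eta p h) A = \<dots>" .
qed

lemma mu_breve_eq_distr:
  assumes "\<tau> > 0"
  shows "mu_breve p h \<tau>
    = distr (density (measure_pmf p) (\<lambda>j. ennreal ((real j - 1) / \<tau>))) borel (\<lambda>j. real j * h)"
proof (rule measure_eqI)
  let ?D = "distr (density (measure_pmf p) (\<lambda>j. ennreal ((real j - 1) / \<tau>))) borel (\<lambda>j. real j * h)"
  show "sets (mu_breve p h \<tau>) = sets ?D"
    by (simp add: mu_breve_def point_masses_def)
  fix A assume "A \<in> sets (mu_breve p h \<tau>)"
  then have A: "A \<in> sets borel" by (simp add: mu_breve_def point_masses_def)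
  have small: "ennreal ((real j - 1) / \<tau>) = 0" if "j < 2" for j :: nat
    using that assms by (auto simp: ennreal_eq_0_iff divide_le_0_iff)
  have "emeasure (mu_breve p h \<tau>) A
      = (\<integral>\<^sup>+j. ennreal (1 / \<tau> * ((real j - 1) * pmf p j)) * indicator A (real j * h) \<partial>count_space {2..})"
    unfolding mu_breve_def by (rule emeasure_point_masses[OF A])
  also have "\<dots> = (\<integral>\<^sup>+j. ennreal (1 / \<tau> * ((real j - 1) * pmf p j)) * indicator A (real j * h)
      * indicator {2..} j \<partial>count_space UNIV)"
    by (subst nn_integral_count_space_indicator) auto
  also have "\<dots> = (\<integral>\<^sup>+j. ennreal (pmf p j) * (ennreal ((real j - 1) / \<tau>) * indicator A (real j
      * h)) \<partial>count_space UNIV)"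
  proof (rule nn_integral_cong)
    fix j :: nat
    show "ennreal (1 / \<tau> * ((real j - 1) * pmf p j)) * indicator A (real j * h) * indicator {2..} j
      = ennreal (pmf p j) * (ennreal ((real j - 1) / \<tau>) * indicator A (real j * h))"
    proof (cases "2 \<le> j")
      case True
      have "1 / \<tau> * ((real j - 1) * pmf p j) = pmf p j * ((real j - 1) / \<tau>)" by simp
      then show ?thesis using True assms by (simp add: ennreal_mult mult_ac del: times_divide_eq_right)
    qed (use small in auto)
  qed
  also have "\<dots> = (\<integral>\<^sup>+j. ennreal ((real j - 1) / \<tau>) * indicator A (real j * h) \<partial>measure_pmf p)"
    by (simp add: nn_integral_measure_pmf)
  also have "\<dots> = (\<integral>\<^sup>+j. ennreal ((real j - 1) / \<tau>) * indicator ((\<lambda>j. real j * h) -` A) j \<partial>measure_pmf p)"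
    by (rule nn_integral_cong) (simp add: indicator_def)
  also have "\<dots> = emeasure ?D A"
    using A by (simp add: emeasure_distr emeasure_density)
  finally show "emeasure (mu_breve p h \<tau>) A = \<dots>" .
qed

text \<open>
The measure \<open>(x \<and> 1) d mu_breve\<close>, whose weak convergence on \<open>[0,\<infinity>]\<close> is Levy-convergence.
\<close>

definition clipped_mu :: "nat pmf \<Rightarrow> real \<Rightarrow> real \<Rightarrow> real measure" where
  "clipped_mu p h \<tau> = density (mu_breve p h \<tau>) (\<lambda>y. ennreal (min y 1))"

lemma sets_mu_breve [simp, measurable_cong]: "sets (mu_breve p h \<tau>) = sets borel"
  by (simp add: mu_breve_def point_masses_def)

lemma sets_clipped_mu [simp, measurable_cong]: "sets (clipped_mu p h \<tau>) = sets borel"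
  by (simp add: clipped_mu_def)

lemma space_clipped_mu [simp]: "space (clipped_mu p h \<tau>) = UNIV"
  by (simp add: clipped_mu_def mu_breve_def point_masses_def)

lemma AE_mu_breve:
  assumes "\<tau> > 0" "h > 0"
  shows "AE y in mu_breve p h \<tau>. 2 * h \<le> y"
proof -
  have "ennreal ((real j - 1) / \<tau>) = 0" if "j < 2" for j :: nat
    using that assms by (auto simp: ennreal_eq_0_iff divide_le_0_iff)
  then have "2 * h \<le> real j * h" if "ennreal ((real j - 1) / \<tau>) > 0" for j
    using that assms by (cases "j < 2") auto
  then show ?thesis
    unfolding mu_breve_eq_distr[OF assms(1)] by (subst AE_distr_iff) (auto simp: AE_density)
qed

lemma AE_clipped_mu:
  assumes "\<tau> > 0" "h > 0"
  shows "AE y in clipped_mu p h \<tau>. 2 * h \<le> y"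
  using AE_mu_breve[OF assms, of p] unfolding clipped_mu_def
  by (subst AE_density) (auto elim: eventually_mono)

lemma nn_integral_clipped_mu:
  assumes "\<tau> > 0" "h > 0" and [measurable]: "f \<in> borel_measurable borel"
  shows "(\<integral>\<^sup>+y. f y \<partial>clipped_mu p h \<tau>)
    = (\<integral>\<^sup>+j. ennreal (min (real j * h) 1 * ((real j - 1) / \<tau>)) * f (real j * h) \<partial>measure_pmf p)"
proof -
  have "ennreal ((real j - 1) / \<tau>) * (ennreal (min (real j * h) 1) * f (real j * h))
     = ennreal (min (real j * h) 1 * ((real j - 1) / \<tau>)) * f (real j * h)" for j :: nat
  proof (cases "2 \<le> j")
    case True
    then show ?thesis using assms by (subst ennreal_mult) (auto simp: mult_ac)
  next
    case False
    then have "j = 0 \<or> j = 1" by auto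
    then show ?thesis using assms by (auto simp: ennreal_eq_0_iff)
  qed
  then show ?thesis
    unfolding clipped_mu_def mu_breve_eq_distr[OF assms(1)]
    by (simp add: nn_integral_density nn_integral_distr)
qed

lemma integral_clipped_mu:
  fixes f :: "real \<Rightarrow> real"
  assumes "\<tau> > 0" "h > 0" and [measurable]: "f \<in> borel_measurable borel"
  shows "(\<integral>y. f y \<partial>clipped_mu p h \<tau>)
    = (\<integral>j. min (real j * h) 1 * ((real j - 1) / \<tau>) * f (real j * h) \<partial>measure_pmf p)"
proof -
  have wt: "0 \<le> min (real j * h) 1 * ((real j - 1) / \<tau>)" for j :: nat
    using assms by (cases "j = 0") auto
  have "clipped_mu p h \<tau> = distr (density (measure_pmf p)
      (\<lambda>j. ennreal (min (real j * h) 1 * ((real j - 1) / \<tau>)))) borel (\<lambda>j. real j * h)" (is "_ = ?R")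
  proof (rule measure_eqI)
    fix A assume "A \<in> sets (clipped_mu p h \<tau>)"
    then have A [measurable]: "A \<in> sets borel" by simp
    have "emeasure (clipped_mu p h \<tau>) A = (\<integral>\<^sup>+y. indicator A y \<partial>clipped_mu p h \<tau>)" by simp
    also have "\<dots> = (\<integral>\<^sup>+y. indicator A y \<partial>?R)"
      using assms
      by (subst nn_integral_clipped_mu)
          (simp_all add: nn_integral_density nn_integral_distr del: nn_integral_indicator)
    also have "\<dots> = emeasure ?R A" by (rule nn_integral_indicator) simp
    finally show "emeasure (clipped_mu p h \<tau>) A = emeasure ?R A" .
  qed simp
  then show ?thesis using wt by (simp add: integral_distr integral_density)
qed

lemma integral_mu_breve:
  fixes g :: "real \<Rightarrow> real"
  assumes "\<tau> > 0" "h > 0" and [measurable]: "g \<in> borel_measurable borel"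
  shows "(\<integral>x. g x * min x 1 \<partial>mu_breve p h \<tau>) = (\<integral>y. g y \<partial>clipped_mu p h \<tau>)"
  unfolding clipped_mu_def using AE_mu_breve[OF assms(1,2), of p] assms(2)
  by (subst integral_density) (auto simp: mult.commute elim!: eventually_mono)

lemma emeasure_eta_tail:
   "emeasure (eta p h) {x..} = (\<integral>\<^sup>+j. indicator {x..} ((real j - 1) * h) \<partial>measure_pmf p)"
proof -
  have "emeasure (eta p h) {x..} = (\<integral>\<^sup>+y. indicator {x..} y \<partial>eta p h)"
    by (simp add: eta_eq_distr)
  then show ?thesis by (simp add: eta_eq_distr nn_integral_distr del: nn_integral_indicator)
qed

context
  fixes p :: "nat pmf" and h \<tau> :: real
  assumes mean_one: "(\<lambda>j. real j * pmf p j) sums 1" and h: "h > 0" and tau: "\<tau> > 0"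
begin

lemma mean: "integrable (measure_pmf p) real" "(\<integral>j. real j \<partial>measure_pmf p) = 1"
proof -
  have i: "integrable (count_space UNIV) (\<lambda>j. pmf p j * real j)"
    using mean_one by (simp add: integrable_count_space_nat_iff sums_iff mult.commute)
  then show "integrable (measure_pmf p) real"
    unfolding measure_pmf_eq_density by (subst integrable_density) auto
  have "(\<integral>j. real j \<partial>measure_pmf p) = (\<integral>j. pmf p j * real j \<partial>count_space UNIV)"
    unfolding measure_pmf_eq_density by (subst integral_density) auto
  also have "\<dots> = 1" using i mean_one
      by (subst integral_count_space_nat) (simp_all add: sums_iff mult.commute)
  finally show "(\<integral>j. real j \<partial>measure_pmf p) = 1" .
qed

lemma finite_measure_clipped_mu: "finite_measure (clipped_mu p h \<tau>)"
proof
  have "emeasure (clipped_mu p h \<tau>) (space (clipped_mu p h \<tau>)) = (\<integral>\<^sup>+y. 1 \<partial>clipped_mu p h \<tau>)" by simp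
  also have "\<dots> = (\<integral>\<^sup>+j. ennreal (min (real j * h) 1 * ((real j - 1) / \<tau>)) \<partial>measure_pmf p)"
    using h tau by (subst nn_integral_clipped_mu) auto
  also have "\<dots> \<le> (\<integral>\<^sup>+j. ennreal (real j / \<tau>) \<partial>measure_pmf p)"
  proof (intro nn_integral_mono ennreal_leI)
    fix j :: nat
    have "min (real j * h) 1 * ((real j - 1) / \<tau>) \<le> 1 * ((real j - 1) / \<tau>)" if "j \<ge> 1"
      using that tau by (intro mult_right_mono) auto
    also have "\<dots> \<le> real j / \<tau>" using tau by (simp add: divide_right_mono)
    finally show "min (real j * h) 1 * ((real j - 1) / \<tau>) \<le> real j / \<tau>"
      using tau by (cases "j = 0") auto
  qed
  also have "\<dots> < \<infinity>" using mean(1) tau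
    by (subst nn_integral_eq_integral) auto
  finally show "emeasure (clipped_mu p h \<tau>) (space (clipped_mu p h \<tau>)) \<noteq> \<infinity>" by simp
qed

text \<open>
The jump \<open>X = (j - 1) h\<close> has mean zero, so a multiple of \<open>X\<close> can be added to either integrand. The
multiples \<open>- X / (1 + h\<^sup>2)\<close> and \<open>h X / (1 + h\<^sup>2)\<close> are those for which the integrand vanishes at
\<open>X = - h\<close>. The atom of \<open>eta\<close> at \<open>- h\<close>, which \<open>mu_breve\<close> does not see, then no longer contributes,
and what remains has the factor \<open>X (X + h)\<close>, which is proportional to the weight of \<open>mu_breve\<close>.
\<close>

lemma integral_eta_kernel:
  shows "(\<integral>x. x / (1 + x\<^sup>2) \<partial>eta p h) / (h * \<tau>) = - (\<integral>y. kernel_inf h y \<partial>clipped_mu p h \<tau>)"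
    and "(\<integral>x. x\<^sup>2 / (1 + x\<^sup>2) \<partial>eta p h) / (h * \<tau>) = (\<integral>y. kernel_zero h y \<partial>clipped_mu p h \<tau>)"
proof -
  let ?X = "\<lambda>j::nat. (real j - 1) * h"
  have D: "1 + z\<^sup>2 > 0" for z :: real by (simp add: add_pos_nonneg)
  have bnd: "\<bar>z / (1 + z\<^sup>2)\<bar> \<le> 1" "\<bar>z\<^sup>2 / (1 + z\<^sup>2)\<bar> \<le> 1" for z :: real
  proof -
    have "\<bar>z\<bar> \<le> 1 + z\<^sup>2" using zero_le_power2[of "\<bar>z\<bar> - 1/2"] zero_le_power2[of z]
      by (auto simp: power2_eq_square algebra_simps)
    then show "\<bar>z / (1 + z\<^sup>2)\<bar> \<le> 1" "\<bar>z\<^sup>2 / (1 + z\<^sup>2)\<bar> \<le> 1" using D[of z]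
      by (auto simp: abs_mult divide_le_eq)
  qed
  have i1: "integrable (measure_pmf p) (\<lambda>j. ?X j / (1 + (?X j)\<^sup>2))"
   "integrable (measure_pmf p) (\<lambda>j. (?X j)\<^sup>2 / (1 + (?X j)\<^sup>2))"
    using bnd by (auto intro!: measure_pmf.integrable_const_bound[where B = 1])
  have X: "integrable (measure_pmf p) ?X" "(\<integral>j. ?X j \<partial>measure_pmf p) = 0"
    using mean by (auto simp: algebra_simps measure_pmf.prob_space)
  have wt: "min (real j * h) 1 * ((real j - 1) / \<tau>) * max (real j * h) 1 = ?X j * real j / \<tau>" for j :: nat
    by (simp add: min_def max_def mult_ac)
  have alg1: "X / (1 + X\<^sup>2) - X / (1 + h\<^sup>2) = - X * (X + h) * (X - h) / ((1 + X\<^sup>2) * (1 + h\<^sup>2))"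
      for X :: real
  proof -
    have "X / (1 + X\<^sup>2) - X / (1 + h\<^sup>2) = X * ((1 + h\<^sup>2) - (1 + X\<^sup>2)) / ((1 + X\<^sup>2) * (1 + h\<^sup>2))"
      using D[of X] D[of h] diff_frac_eq[of "1 + X\<^sup>2" "1 + h\<^sup>2" X X] by (simp add: algebra_simps)
    also have "X * ((1 + h\<^sup>2) - (1 + X\<^sup>2)) = - X * (X + h) * (X - h)"
      by (simp add: algebra_simps power2_eq_square)
    finally show ?thesis .
  qed
  have alg2: "X\<^sup>2 / (1 + X\<^sup>2) + h / (1 + h\<^sup>2) * X = X * (X + h) * (1 + h * X) / ((1 + X\<^sup>2) * (1 + h\<^sup>2))"
      for X :: real
  proof -
    have "X\<^sup>2 / (1 + X\<^sup>2) + h / (1 + h\<^sup>2) * X = X\<^sup>2 / (1 + X\<^sup>2) + (h * X) / (1 + h\<^sup>2)" by simp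
    also have "\<dots> = (X\<^sup>2 * (1 + h\<^sup>2) + (h * X) * (1 + X\<^sup>2)) / ((1 + X\<^sup>2) * (1 + h\<^sup>2))"
      using D[of X] D[of h] by (intro add_frac_eq) auto
    also have "X\<^sup>2 * (1 + h\<^sup>2) + (h * X) * (1 + X\<^sup>2) = X * (X + h) * (1 + h * X)"
      by (simp add: algebra_simps power2_eq_square)
    finally show ?thesis .
  qed
  have e1: "?X j / (1 + (?X j)\<^sup>2) - ?X j / (1 + h\<^sup>2)
    = (h * \<tau>) * - (min (real j * h) 1 * ((real j - 1) / \<tau>) * kernel_inf h (real j * h))" for j :: nat
  proof -
    have "real j * h - h = ?X j" "real j * h - 2 * h = ?X j - h" by (simp_all add: algebra_simps)
    then have "kernel_inf h (real j * h)
      = max (real j * h) 1 * ((?X j - h) / ((1 + (?X j)\<^sup>2) * (1 + h\<^sup>2)))"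
      by (simp only: kernel_inf_def times_divide_eq_right)
    then have "min (real j * h) 1 * ((real j - 1) / \<tau>) * kernel_inf h (real j * h)
      = (?X j * real j / \<tau>) * ((?X j - h) / ((1 + (?X j)\<^sup>2) * (1 + h\<^sup>2)))"
      unfolding wt[symmetric] by (simp only: mult.assoc)
    moreover have "?X j / (1 + (?X j)\<^sup>2) - ?X j / (1 + h\<^sup>2)
       = - ?X j * (?X j + h) * (?X j - h) / ((1 + (?X j)\<^sup>2) * (1 + h\<^sup>2))"
      using alg1 .
    moreover have "?X j + h = real j * h" by (simp add: algebra_simps)
    ultimately show ?thesis using tau by simp
  qed
  have e2: "(?X j)\<^sup>2 / (1 + (?X j)\<^sup>2) + h / (1 + h\<^sup>2) * ?X j
    = (h * \<tau>) * (min (real j * h) 1 * ((real j - 1) / \<tau>) * kernel_zero h (real j * h))" for j :: nat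
  proof -
    have "real j * h - h = ?X j" by (simp add: algebra_simps)
    then have "kernel_zero h (real j * h)
      = max (real j * h) 1 * ((1 + h * ?X j) / ((1 + (?X j)\<^sup>2) * (1 + h\<^sup>2)))"
      by (simp only: kernel_zero_def times_divide_eq_right)
    then have "min (real j * h) 1 * ((real j - 1) / \<tau>) * kernel_zero h (real j * h)
      = (?X j * real j / \<tau>) * ((1 + h * ?X j) / ((1 + (?X j)\<^sup>2) * (1 + h\<^sup>2)))"
      unfolding wt[symmetric] by (simp only: mult.assoc)
    moreover have "(?X j)\<^sup>2 / (1 + (?X j)\<^sup>2) + h / (1 + h\<^sup>2) * ?X j
       = ?X j * (?X j + h) * (1 + h * ?X j) / ((1 + (?X j)\<^sup>2) * (1 + h\<^sup>2))"
      using alg2 .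
    moreover have "?X j + h = real j * h" by (simp add: algebra_simps)
    ultimately show ?thesis using tau by simp
  qed
  have "(\<integral>x. x / (1 + x\<^sup>2) \<partial>eta p h) = (\<integral>j. ?X j / (1 + (?X j)\<^sup>2) \<partial>measure_pmf p)"
    by (simp add: eta_eq_distr integral_distr)
  also have "\<dots> = (\<integral>j. ?X j / (1 + (?X j)\<^sup>2) - ?X j / (1 + h\<^sup>2) \<partial>measure_pmf p)"
    using i1 X by simp
  also have "\<dots> = (h * \<tau>) * - (\<integral>y. kernel_inf h y \<partial>clipped_mu p h \<tau>)"
    using h tau unfolding e1 by (simp add: integral_clipped_mu mult.assoc)
  finally show "(\<integral>x. x / (1 + x\<^sup>2) \<partial>eta p h) / (h * \<tau>) = - (\<integral>y. kernel_inf h y \<partial>clipped_mu p h \<tau>)"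
    using h tau by simp
  have "(\<integral>x. x\<^sup>2 / (1 + x\<^sup>2) \<partial>eta p h) = (\<integral>j. (?X j)\<^sup>2 / (1 + (?X j)\<^sup>2) \<partial>measure_pmf p)"
    by (simp add: eta_eq_distr integral_distr)
  also have "\<dots> = (\<integral>j. (?X j)\<^sup>2 / (1 + (?X j)\<^sup>2) + h / (1 + h\<^sup>2) * ?X j \<partial>measure_pmf p)"
    using i1 X by simp
  also have "\<dots> = (h * \<tau>) * (\<integral>y. kernel_zero h y \<partial>clipped_mu p h \<tau>)"
    using h tau unfolding e2 by (simp add: integral_clipped_mu mult.assoc)
  finally show "(\<integral>x. x\<^sup>2 / (1 + x\<^sup>2) \<partial>eta p h) / (h * \<tau>) = (\<integral>y. kernel_zero h y \<partial>clipped_mu p h \<tau>)"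
    using h tau by simp
qed

end

text \<open>
The limiting ratio between \<open>clipped_mu\<close> and the rescaled jump measure \<open>eta / (h \<tau>)\<close>: the atom of
\<open>mu_breve\<close> at \<open>y = j h\<close> has \<open>(j - 1) h = y - h\<close> times the mass of the corresponding atom of
\<open>eta / (h \<tau>)\<close>, and \<open>clipped_mu\<close> contributes the factor \<open>y \<and> 1\<close>.
\<close>

definition levy_wt :: "real \<Rightarrow> real" where
  "levy_wt y = y * min y 1"

text \<open>
Approximately \<open>eta / (h \<tau>)\<close> on the positive half-line, but with atoms at those of \<open>mu_breve\<close>.
\<close>

definition jump_mu :: "nat pmf \<Rightarrow> real \<Rightarrow> real \<Rightarrow> real measure" where
  "jump_mu p h \<tau> = density (clipped_mu p h \<tau>) (\<lambda>y. ennreal (1 / levy_wt y))"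

lemma measurable_levy_wt [measurable]: "levy_wt \<in> borel_measurable borel"
  unfolding levy_wt_def [abs_def] by measurable

lemma emeasure_jump_mu_tail:
  assumes "\<tau> > 0" "h > 0" "0 < z"
  shows "emeasure (jump_mu p h \<tau>) {z..}
      = (\<integral>\<^sup>+j. ennreal ((real j - 1) / (real j * h * \<tau>)) * indicator {z..} (real j * h) \<partial>measure_pmf p)"
proof -
  have "emeasure (jump_mu p h \<tau>) {z..}
      = (\<integral>\<^sup>+y. ennreal (1 / levy_wt y) * indicator {z..} y \<partial>clipped_mu p h \<tau>)"
    by (simp add: jump_mu_def emeasure_density)
  also have "\<dots> = (\<integral>\<^sup>+j. ennreal (min (real j * h) 1 * ((real j - 1) / \<tau>))
      * (ennreal (1 / levy_wt (real j * h)) * indicator {z..} (real j * h)) \<partial>measure_pmf p)"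
    using assms by (subst nn_integral_clipped_mu) auto
  also have "\<dots> = (\<integral>\<^sup>+j. ennreal ((real j - 1) / (real j * h * \<tau>)) * indicator {z..} (real j
      * h) \<partial>measure_pmf p)"
  proof (rule nn_integral_cong)
    fix j :: nat
    show "ennreal (min (real j * h) 1 * ((real j - 1) / \<tau>)) * (ennreal (1 / levy_wt (real j * h))
        * indicator {z..} (real j * h))
      = ennreal ((real j - 1) / (real j * h * \<tau>)) * indicator {z..} (real j * h)"
    proof (cases "j = 0")
      case False
      have "min (real j * h) 1 * ((real j - 1) / \<tau>) * (1 / levy_wt (real j * h))
          = (real j - 1) / (real j * h * \<tau>)"
        using False assms by (auto simp: levy_wt_def min_def)
      moreover have "0 \<le> min (real j * h) 1 * ((real j - 1) / \<tau>)" "0 \<le> 1 / levy_wt (real j * h)"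
        using False assms by (auto simp: levy_wt_def)
      ultimately show ?thesis by
          (simp add: mult.assoc[symmetric] ennreal_mult[symmetric] del: times_divide_eq_right)
    qed simp
  qed
  finally show ?thesis .
qed

text \<open>
The atom of \<open>eta / (h \<tau>)\<close> at \<open>(j - 1) h\<close> and that of \<open>jump_mu\<close> at \<open>j h\<close> have masses in the ratio
\<open>j / (j - 1)\<close>, which is at least 1 and at most \<open>1 + h / x\<close> as soon as \<open>(j - 1) h \<ge> x\<close>.
\<close>

lemma tail_comparison:
  assumes "\<tau> > 0" "h > 0" "0 < x"
  shows "emeasure (jump_mu p h \<tau>) {x + h..} \<le> emeasure (eta p h) {x..} / ennreal (h * \<tau>)"
    and "emeasure (eta p h) {x..} / ennreal (h * \<tau>)
        \<le> ennreal (1 + h / x) * emeasure (jump_mu p h \<tau>) {x + h..}"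
proof -
  have ind: "indicator {x..} ((real j - 1) * h) = (indicator {x + h..} (real j * h) :: ennreal)"
      for j :: nat
    by (simp add: indicator_def algebra_simps)
  have T: "emeasure (eta p h) {x..} / ennreal (h * \<tau>)
      = (\<integral>\<^sup>+j. ennreal (1 / (h * \<tau>)) * indicator {x + h..} (real j * h) \<partial>measure_pmf p)"
    using assms unfolding emeasure_eta_tail ind
    by (simp add: nn_integral_cmult divide_ennreal_def mult.commute inverse_ennreal divide_inverse)
  show "emeasure (jump_mu p h \<tau>) {x + h..} \<le> emeasure (eta p h) {x..} / ennreal (h * \<tau>)"
    unfolding T using assms
  proof (subst emeasure_jump_mu_tail, simp_all, intro nn_integral_mono mult_right_mono ennreal_leI)
    fix j :: nat
    show "(real j - 1) / (real j * h * \<tau>) \<le> 1 / (h * \<tau>)"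
      using assms by (cases "j = 0") (auto simp: field_simps)
  qed auto
  have "emeasure (eta p h) {x..} / ennreal (h * \<tau>)
      \<le> (\<integral>\<^sup>+j. ennreal (1 + h / x) * (ennreal ((real j - 1) / (real j * h * \<tau>)) * indicator {x
          + h..} (real j * h)) \<partial>measure_pmf p)"
    unfolding T
  proof (intro nn_integral_mono)
    fix j :: nat
    show "ennreal (1 / (h * \<tau>)) * indicator {x + h..} (real j * h)
        \<le> ennreal (1 + h / x) * (ennreal ((real j - 1) / (real j * h * \<tau>)) * indicator {x
            + h..} (real j * h))"
    proof (cases "x + h \<le> real j * h")
      case True
      then have j: "x \<le> (real j - 1) * h" by (simp add: algebra_simps)
      with assms have "0 < (real j - 1) * h" by linarith
      then have j1: "real j > 1" using assms by (simp add: zero_less_mult_iff)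
      have "x * real j \<le> (x + h) * (real j - 1)" using j by (simp add: algebra_simps)
      then have "1 / (h * \<tau>) \<le> (1 + h / x) * ((real j - 1) / (real j * h * \<tau>))"
        using assms j1 by (simp add: divide_simps mult_ac)
      then have "ennreal (1 / (h * \<tau>)) \<le> ennreal (1 + h / x) * ennreal ((real j - 1) / (real j * h * \<tau>))"
        using assms j1 by (subst ennreal_mult[symmetric]) (auto intro: ennreal_leI)
      then show ?thesis using True by simp
    qed simp
  qed
  also have "\<dots> = ennreal (1 + h / x) * emeasure (jump_mu p h \<tau>) {x + h..}"
    using assms by (simp add: nn_integral_cmult emeasure_jump_mu_tail)
  finally show "emeasure (eta p h) {x..} / ennreal (h * \<tau>)
      \<le> ennreal (1 + h / x) * emeasure (jump_mu p h \<tau>) {x + h..}" .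
qed

section \<open>From Levy-convergence to convergence of the jumps\<close>

lemma levy_wt_mono: "0 \<le> x \<Longrightarrow> x \<le> y \<Longrightarrow> levy_wt x \<le> levy_wt y"
  unfolding levy_wt_def by (intro mult_mono) auto

lemma levy_wt_pos: "0 < y \<Longrightarrow> 0 < levy_wt y"
  by (simp add: levy_wt_def)

text \<open>
Away from 0 the weight is bounded below, so dividing by it turns a finite measure into one with
finite tails.
\<close>

lemma tail_of_inverse_weight:
  fixes M :: "real measure"
  assumes [measurable_cong, simp]: "sets M = sets borel" and "finite_measure M" and x: "0 < x"
  shows "integrable M (\<lambda>y. indicator {x..} y / levy_wt y)"
    and "emeasure (density M (\<lambda>y. ennreal (1 / levy_wt y))) {x..}
           = ennreal (\<integral>y. indicator {x..} y / levy_wt y \<partial>M)"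
    and "measure (density M (\<lambda>y. ennreal (1 / levy_wt y))) {x..} = (\<integral>y. indicator {x..} y / levy_wt y \<partial>M)"
    and "measure (density M (\<lambda>y. ennreal (1 / levy_wt y))) {x..} \<le> measure M (space M) / levy_wt x"
proof -
  interpret finite_measure M by fact
  have bd: "0 \<le> indicator {x..} y / levy_wt y \<and> indicator {x..} y / levy_wt y \<le> 1 / levy_wt x" for y
    using x levy_wt_mono[of x y] levy_wt_pos[of x] levy_wt_pos[of y]
    by (cases "x \<le> y") (auto simp: frac_le)
  show int: "integrable M (\<lambda>y. indicator {x..} y / levy_wt y)"
    using bd by (intro integrable_const_bound[where B
        = "1 / levy_wt x"] AE_I2) (simp_all only: real_norm_def abs_of_nonneg, measurable)
  have "emeasure (density M (\<lambda>y. ennreal (1 / levy_wt y))) {x..}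
      = (\<integral>\<^sup>+y. ennreal (1 / levy_wt y) * indicator {x..} y \<partial>M)"
    by (simp add: emeasure_density)
  also have "\<dots> = (\<integral>\<^sup>+y. ennreal (indicator {x..} y / levy_wt y) \<partial>M)"
    by (intro nn_integral_cong) (simp add: indicator_def)
  also have "\<dots> = ennreal (\<integral>y. indicator {x..} y / levy_wt y \<partial>M)"
    using bd by (intro nn_integral_eq_integral int) auto
  finally show em: "emeasure (density M (\<lambda>y. ennreal (1 / levy_wt y))) {x..} = \<dots>" .
  have nn: "0 \<le> (\<integral>y. indicator {x..} y / levy_wt y \<partial>M)" using bd by (intro integral_nonneg_AE) auto
  with em show me: "measure (density M (\<lambda>y. ennreal (1 / levy_wt y))) {x..}
      = (\<integral>y. indicator {x..} y / levy_wt y \<partial>M)"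
    by (simp add: measure_def)
  have "(\<integral>y. indicator {x..} y / levy_wt y \<partial>M) \<le> (\<integral>y. 1 / levy_wt x \<partial>M)"
    using bd by (intro integral_mono int) auto
  then show "measure (density M (\<lambda>y. ennreal (1 / levy_wt y))) {x..} \<le> measure M (space M) / levy_wt x"
    by (simp add: me)
qed

text \<open>
\<open>R k\<close> is the measure whose weak convergence is at stake, \<open>jump_tail k x\<close> is the rescaled tail of
\<open>eta\<close>, and \<open>V k\<close> mediates between the two.
\<close>

locale rescaled_offspring =
  fixes p :: "nat \<Rightarrow> nat pmf" and h \<tau> :: "nat \<Rightarrow> real"
  assumes mean_one: "\<And>k. (\<lambda>j. real j * pmf (p k) j) sums 1"
    and h_pos: "\<And>k. h k > 0" and h_lim: "h \<longlonglongrightarrow> 0"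
    and tau_pos: "\<And>k. \<tau> k > 0"
begin

abbreviation R :: "nat \<Rightarrow> real measure" where "R k \<equiv> clipped_mu (p k) (h k) (\<tau> k)"
abbreviation V :: "nat \<Rightarrow> real measure" where "V k \<equiv> jump_mu (p k) (h k) (\<tau> k)"
abbreviation jump_tail :: "nat \<Rightarrow> real \<Rightarrow> ennreal" where
  "jump_tail k x \<equiv> emeasure (eta (p k) (h k)) {x..} / ennreal (h k * \<tau> k)"

lemma finite_R: "finite_measure (R k)"
  by (rule finite_measure_clipped_mu[OF mean_one h_pos tau_pos])

lemma AE_R: "AE y in R k. 2 * h k \<le> y" "AE y in R k. 0 < y"
  using AE_clipped_mu[OF tau_pos[of k] h_pos[of k], of "p k"] h_pos[of k] by (auto elim!: eventually_mono)

lemma h_small: "0 < c \<Longrightarrow> \<forall>\<^sub>F k in sequentially. h k < c"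
  using h_lim by (rule order_tendstoD)

lemma integrable_kernel:
  assumes close: "\<And>h y. 0 < h \<Longrightarrow> h \<le> 1 \<Longrightarrow> 2 * h \<le> y \<Longrightarrow> \<bar>\<phi> h y - \<phi> 0 y\<bar> \<le> 10 * h"
    and [measurable]: "\<And>h. \<phi> h \<in> borel_measurable borel"
    and bd: "\<And>y. 0 \<le> y \<Longrightarrow> \<bar>\<phi> 0 y\<bar> \<le> 2"
  shows "integrable (R k) (\<phi> 0)" and "h k < 1 \<Longrightarrow> integrable (R k) (\<phi> (h k))"
proof -
  interpret finite_measure "R k" by (rule finite_R)
  show "integrable (R k) (\<phi> 0)" using AE_R(2)[of k] bd
    by (intro integrable_const_bound[where B = 2]) (auto elim!: eventually_mono)
  show "integrable (R k) (\<phi> (h k))" if "h k < 1"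
  proof -
    have "\<bar>\<phi> (h k) y\<bar> \<le> 12" if "2 * h k \<le> y" for y
      using close[of "h k" y] bd[of y] h_pos[of k] that \<open>h k < 1\<close> by linarith
    then show ?thesis using AE_R(1)[of k]
      by (intro integrable_const_bound[where B = 12]) (auto elim!: eventually_mono)
  qed
qed

lemma integral_kernel_limit:
  assumes close: "\<And>h y. 0 < h \<Longrightarrow> h \<le> 1 \<Longrightarrow> 2 * h \<le> y \<Longrightarrow> \<bar>\<phi> h y - \<phi> 0 y\<bar> \<le> 10 * h"
    and meas: "\<And>h. \<phi> h \<in> borel_measurable borel"
    and bd: "\<And>y. 0 \<le> y \<Longrightarrow> \<bar>\<phi> 0 y\<bar> \<le> 2"
    and mass: "\<forall>\<^sub>F k in sequentially. measure (R k) UNIV \<le> B"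
  shows "(\<lambda>k. (\<integral>y. \<phi> (h k) y \<partial>R k) - (\<integral>y. \<phi> 0 y \<partial>R k)) \<longlonglongrightarrow> 0"
proof -
  have i0: "integrable (R k) (\<phi> 0)" and ih: "h k < 1 \<Longrightarrow> integrable (R k) (\<phi> (h k))" for k
    by (rule integrable_kernel[of \<phi>]; use close meas bd in simp)+
  have "\<forall>\<^sub>F k in sequentially. norm ((\<integral>y. \<phi> (h k) y \<partial>R k) - (\<integral>y. \<phi> 0 y \<partial>R k)) \<le> norm (h k) * (10 * B)"
    using h_small[OF zero_less_one] mass
  proof eventually_elim
    case (elim k)
    note k = elim
    interpret finite_measure "R k" by (rule finite_R)
    have "\<bar>(\<integral>y. \<phi> (h k) y \<partial>R k) - (\<integral>y. \<phi> 0 y \<partial>R k)\<bar> = \<bar>\<integral>y. \<phi> (h k) y - \<phi> 0 y \<partial>R k\<bar>"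
      using i0 ih[OF k(1)] by simp
    also have "\<dots> \<le> (\<integral>y. \<bar>\<phi> (h k) y - \<phi> 0 y\<bar> \<partial>R k)" by (rule integral_abs_bound)
    also have "\<dots> \<le> (\<integral>y. 10 * h k \<partial>R k)"
      using i0 ih[OF k(1)] AE_R(1)[of k] close[of "h k"] h_pos[of k] k(1)
      by (intro integral_mono_AE) (auto elim!: eventually_mono)
    also have "\<dots> = 10 * h k * measure (R k) UNIV" by simp
    also have "\<dots> \<le> 10 * h k * B" using k h_pos[of k] by (intro mult_left_mono) auto
    finally show ?case
      using h_pos[of k] by simp
  qed
  then show ?thesis
    by (rule tendsto_0_le[OF h_lim])
qed

lemma kernel_bounds_abs: "0 \<le> y \<Longrightarrow> \<bar>kernel_inf 0 y\<bar> \<le> 2" "0 \<le> y \<Longrightarrow> \<bar>kernel_zero 0 y\<bar> \<le> 2"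
  using kernel_bounded[of y] by auto

lemma kernel_inf_limit:
  assumes "\<forall>\<^sub>F k in sequentially. measure (R k) UNIV \<le> B"
  shows "(\<lambda>k. (\<integral>y. kernel_inf (h k) y \<partial>R k) - (\<integral>y. kernel_inf 0 y \<partial>R k)) \<longlonglongrightarrow> 0"
  by (rule integral_kernel_limit; use assms kernel_close kernel_bounds_abs in simp)

lemma kernel_zero_limit:
  assumes "\<forall>\<^sub>F k in sequentially. measure (R k) UNIV \<le> B"
  shows "(\<lambda>k. (\<integral>y. kernel_zero (h k) y \<partial>R k) - (\<integral>y. kernel_zero 0 y \<partial>R k)) \<longlonglongrightarrow> 0"
  by (rule integral_kernel_limit; use assms kernel_close kernel_bounds_abs in simp)

lemma V_tail:
  assumes "0 < x"
  shows "measure (V k) {x..} = (\<integral>y. indicator {x..} y / levy_wt y \<partial>R k)"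
    and "emeasure (V k) {x..} = ennreal (measure (V k) {x..})"
    and "measure (V k) {x..} \<le> measure (R k) UNIV / levy_wt x"
  using tail_of_inverse_weight[OF sets_clipped_mu finite_R assms, of k] by (simp_all add: jump_mu_def)

lemma V_antimono:
  assumes "0 < x" "x \<le> y"
  shows "measure (V k) {y..} \<le> measure (V k) {x..}"
proof -
  have "emeasure (V k) {y..} \<le> emeasure (V k) {x..}"
    using assms by (intro emeasure_mono) (auto simp: jump_mu_def)
  then show ?thesis using assms by (simp add: V_tail(2))
qed

lemma jump_tail_bounds:
  assumes "0 < x"
  shows "jump_tail k x = ennreal (enn2real (jump_tail k x))"
    and "measure (V k) {x + h k..} \<le> enn2real (jump_tail k x)"
    and "enn2real (jump_tail k x) \<le> (1 + h k / x) * measure (V k) {x + h k..}"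
proof -
  have pos: "0 < x + h k" "0 \<le> 1 + h k / x" using assms h_pos[of k] by (auto intro: add_nonneg_nonneg)
  note cmp = tail_comparison[OF tau_pos[of k] h_pos[of k] assms, of "p k", unfolded V_tail(2)[OF pos(1)]]
  have up: "jump_tail k x \<le> ennreal ((1 + h k / x) * measure (V k) {x + h k..})"
    using cmp(2) pos by (simp add: ennreal_mult)
  then have "jump_tail k x < \<infinity>" by (metis ennreal_less_top infinity_ennreal_def le_less_trans)
  then show eq: "jump_tail k x = ennreal (enn2real (jump_tail k x))" by simp
  show "measure (V k) {x + h k..} \<le> enn2real (jump_tail k x)"
    using cmp(1) by (subst (asm) eq) (simp add: ennreal_le_iff)
  show "enn2real (jump_tail k x) \<le> (1 + h k / x) * measure (V k) {x + h k..}"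
    using up pos by (subst (asm) eq) (simp add: ennreal_le_iff)
qed

text \<open>
The kernels for \<open>h = 0\<close> are test functions on \<open>[0,\<infinity>]\<close>, so their integrals converge; up to sign these
are the limits of the truncated moments. The measure \<open>F\<close> is the limit \<open>K\<close> on \<open>(0,\<infinity>)\<close>, divided by the
weight \<open>levy_wt\<close>. For its tails, the indicator of a half-line is enclosed between ramps; a ramp
divided by the weight tends to 0 at infinity, so a mass of \<open>K\<close> at \<open>\<infinity>\<close> does not enter.
\<close>

lemma jump_conditions_from_levy:
  assumes sets_K [measurable_cong, simp]: "sets K = sets borel" and fin: "finite_measure K"
    and lim: "levy_converges (\<lambda>k. mu_breve (p k) (h k) (\<tau> k)) K"
  shows "\<exists>(a::real) (b::real) (F::real measure).
        b \<ge> 0 \<and> sets F = sets (restrict_space borel {0<..}) \<and> sigma_finite_measure F \<and>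
        (\<lambda>k. (\<integral>x. x / (1 + x\<^sup>2) \<partial>eta (p k) (h k)) / (h k * \<tau> k)) \<longlonglongrightarrow> a \<and>
        (\<lambda>k. (\<integral>x. x\<^sup>2 / (1 + x\<^sup>2) \<partial>eta (p k) (h k)) / (h k * \<tau> k)) \<longlonglongrightarrow> b \<and>
        (AE x in lborel. x > 0 \<longrightarrow> (\<lambda>k. jump_tail k x) \<longlonglongrightarrow> emeasure F {x..})"
proof -
  interpret K: finite_measure K by fact
  have levy: "(\<lambda>k. \<integral>y. g (ennreal y) \<partial>R k) \<longlonglongrightarrow> (\<integral>z. g z \<partial>K)" if g: "continuous_on UNIV g"
      for g :: "ennreal \<Rightarrow> real"
  proof -
    have [measurable]: "g \<in> borel_measurable borel" using g by (rule borel_measurable_continuous_onI)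
    have eq: "(\<integral>x. g (ennreal x) * min x 1 \<partial>mu_breve (p k) (h k) (\<tau> k)) = (\<integral>y. g (ennreal y) \<partial>R k)" for k
      by (rule integral_mu_breve[OF tau_pos h_pos]) measurable
    then show ?thesis using lim g by (auto simp: levy_converges_def eq)
  qed
  have test: "(\<lambda>k. \<integral>y. f y \<partial>R k) \<longlonglongrightarrow> (\<integral>z. (if z = \<infinity> then L else f (enn2real z)) \<partial>K)"
    if f: "continuous_on UNIV f" and L: "(f \<longlongrightarrow> L) at_top" for f :: "real \<Rightarrow> real" and L
  proof -
    have [measurable]: "f \<in> borel_measurable borel" using f by (rule borel_measurable_continuous_onI)
    have "(\<integral>y. (if ennreal y = \<infinity> then L else f (enn2real (ennreal y))) \<partial>R k) = (\<integral>y. f y \<partial>R k)" for k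
      using AE_R(2)[of k] by (intro integral_cong_AE) (auto elim!: eventually_mono)
    then show ?thesis using levy[OF ennreal_extension_continuous[OF f L]] by simp
  qed
  define B where "B = measure K (space K) + 1"
  have mass: "\<forall>\<^sub>F k in sequentially. measure (R k) UNIV \<le> B"
  proof -
    have "(\<lambda>k. measure (R k) UNIV) \<longlonglongrightarrow> measure K (space K)" using levy[of "\<lambda>_. 1"] by simp
    then have "\<forall>\<^sub>F k in sequentially. measure (R k) UNIV < B" by (rule order_tendstoD) (simp add: B_def)
    then show ?thesis by (auto elim: eventually_mono)
  qed
  define a where "a = - (\<integral>z. (if z = \<infinity> then 1 else kernel_inf 0 (enn2real z)) \<partial>K)"
  define b where "b = (\<integral>z. (if z = \<infinity> then 0 else kernel_zero 0 (enn2real z)) \<partial>K)"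
  have a: "(\<lambda>k. (\<integral>x. x / (1 + x\<^sup>2) \<partial>eta (p k) (h k)) / (h k * \<tau> k)) \<longlonglongrightarrow> a"
    using tendsto_minus[OF tendsto_add[OF kernel_inf_limit[OF mass] test[OF kernel_limit_continuous(1)
        kernel_limits(3)]]]
    by (simp add: a_def integral_eta_kernel(1)[OF mean_one h_pos tau_pos])
  have b: "(\<lambda>k. (\<integral>x. x\<^sup>2 / (1 + x\<^sup>2) \<partial>eta (p k) (h k)) / (h k * \<tau> k)) \<longlonglongrightarrow> b"
    using tendsto_add[OF kernel_zero_limit[OF mass] test[OF kernel_limit_continuous(2) kernel_limits(4)]]
    by (simp add: b_def integral_eta_kernel(2)[OF mean_one h_pos tau_pos])
  have b0: "b \<ge> 0" unfolding b_def by (intro integral_nonneg_AE AE_I2) (simp add: kernel_bounded)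
  \<comment> \<open>\<open>enn2real\<close> moves a mass at \<open>\<infinity>\<close> to 0, where the restriction to \<open>{0<..}\<close> discards it.\<close>
  define K' where "K' = distr K borel enn2real"
  have K' [measurable_cong, simp]: "sets K' = sets borel" by (simp add: K'_def)
  have finK': "finite_measure K'" unfolding K'_def by (rule K.finite_measure_distr) simp
  then interpret K': finite_measure K' .
  define D where "D = density K' (\<lambda>y. ennreal (1 / levy_wt y))"
  define F where "F = restrict_space D {0<..}"
  have [measurable_cong, simp]: "sets D = sets borel" by (simp add: D_def)
  have setsF: "sets F = sets (restrict_space borel {0<..})"
    unfolding F_def by (intro sets_restrict_space_cong) simp
  have sig: "sigma_finite_measure F" unfolding F_def
  proof (rule sigma_finite_measure_restrict_space)
    show "sigma_finite_measure D" unfolding D_def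
      by (subst K'.sigma_finite_iff_density_finite) auto
  qed simp
  define T where "T x = measure D {x..}" for x
  note Dtail = tail_of_inverse_weight[OF K' finK', folded D_def]
  have F_tail: "emeasure F {x..} = ennreal (T x)" if "0 < x" for x
  proof -
    have "emeasure F {x..} = emeasure D {x..}"
      unfolding F_def using that by (subst emeasure_restrict_space) auto
    then show ?thesis using Dtail(2,3)[OF that] by (simp add: T_def)
  qed
  have Tmono: "T y \<le> T x" if "0 < x" "x \<le> y" for x y
  proof -
    have "emeasure D {y..} \<le> emeasure D {x..}" using that by (intro emeasure_mono) auto
    moreover have "emeasure D {z..} = ennreal (T z)" if "0 < z" for z
      using Dtail(2,3)[OF that] by (simp add: T_def)
    ultimately show ?thesis using that by (simp add: T_def ennreal_le_iff)
  qed
  \<comment> \<open>One convergent sequence of ramp integrals separates the tails at \<open>t\<close> from those at \<open>s\<close>, before and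
    in the limit.\<close>
  have ramp: "\<exists>c. (\<exists>I. I \<longlonglongrightarrow> c \<and> (\<forall>k. measure (V k) {t..} \<le> I k \<and> I k \<le> measure (V k) {s..})) \<and> T t \<le> c
      \<and> c \<le> T s"
    if st: "0 < s" "s < t" for s t
  proof -
    define r where "r y = max 0 (min 1 ((y - s) / (t - s)))" for y
    \<comment> \<open>The maximum changes nothing, as \<open>r\<close> vanishes below \<open>s\<close>, but keeps the denominator positive.\<close>
    define f where "f y = r y / levy_wt (max y s)" for y
    have r: "0 \<le> r y" "r y \<le> 1" "y \<le> s \<Longrightarrow> r y = 0" "t \<le> y \<Longrightarrow> r y = 1" for y
      using st by (auto simp: r_def divide_le_0_iff)
    have f_cont: "continuous_on UNIV f" unfolding f_def r_def levy_wt_def using st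
      by (intro continuous_intros) (auto simp: max_def min_def)
    then have [measurable]: "f \<in> borel_measurable borel" by (rule borel_measurable_continuous_onI)
    have f_lim: "(f \<longlongrightarrow> 0) at_top"
    proof (rule tendsto_0_le[where K = 1])
      show "((\<lambda>y::real. inverse y) \<longlongrightarrow> 0) at_top" by (rule tendsto_inverse_0_at_top) (rule filterlim_ident)
      show "\<forall>\<^sub>F y in at_top. norm (f y) \<le> norm (inverse y) * 1"
      proof (rule eventually_at_top_linorderI[of "max 1 s"])
        fix y assume y: "max 1 s \<le> y"
        then have "max y s = y" "min y 1 = 1" by auto
        then have "f y = r y / y" by (simp add: f_def levy_wt_def)
        then show "norm (f y) \<le> norm (inverse y) * 1" using y r[of y] by (simp add: divide_simps)
      qed
    qed
    have f0: "0 \<le> f y" for y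
    proof -
      have "0 < levy_wt (max y s)" using st by (intro levy_wt_pos) auto
      then show ?thesis using r(1)[of y] by (simp add: f_def)
    qed
    have f_bd: "indicator {t..} y / levy_wt y \<le> f y" "f y \<le> indicator {s..} y / levy_wt y" for y
    proof -
      show "indicator {t..} y / levy_wt y \<le> f y"
      proof (cases "t \<le> y")
        case True
        then show ?thesis using st r(4)[of y] by (simp add: f_def)
      next
        case False
        then show ?thesis using f0[of y] by simp
      qed
      show "f y \<le> indicator {s..} y / levy_wt y"
      proof (cases "s \<le> y")
        case True
        then show ?thesis using st r(2)[of y] levy_wt_pos[of y] by (simp add: f_def divide_right_mono)
      next
        case False
        then show ?thesis using r(3)[of y] by (simp add: f_def)
      qed
    qed
    have sand: "(\<integral>y. indicator {t..} y / levy_wt y \<partial>M) \<le> (\<integral>y. f y \<partial>M)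
        \<and> (\<integral>y. f y \<partial>M) \<le> (\<integral>y. indicator {s..} y / levy_wt y \<partial>M)"
      if [measurable_cong, simp]: "sets M = sets borel" and "finite_measure M" for M :: "real measure"
    proof -
      have i: "integrable M (\<lambda>y. indicator {s..} y / levy_wt y)" "integrable M
          (\<lambda>y. indicator {t..} y / levy_wt y)"
        using tail_of_inverse_weight(1)[OF that] st by auto
      have "integrable M f"
      proof (rule Bochner_Integration.integrable_bound[OF i(1)])
        show "AE y in M. norm (f y) \<le> norm (indicator {s..} y / levy_wt y)"
        proof (rule AE_I2)
          fix y
          show "norm (f y) \<le> norm (indicator {s..} y / levy_wt y)"
              using f0[of y] f_bd(2)[of y] unfolding real_norm_def by linarith
        qed
      qed measurable
      then show ?thesis using i f_bd by (auto intro!: integral_mono)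
    qed
    have "f 0 = 0" using r(3)[of 0] st by (simp add: f_def)
    then have "(\<lambda>z. if z = \<infinity> then 0 else f (enn2real z)) = (\<lambda>z. f (enn2real z))" by (auto simp: fun_eq_iff)
    then have "(\<integral>z. (if z = \<infinity> then 0 else f (enn2real z)) \<partial>K) = (\<integral>y. f y \<partial>K')"
      by (simp add: K'_def integral_distr)
    then have "(\<lambda>k. \<integral>y. f y \<partial>R k) \<longlonglongrightarrow> (\<integral>y. f y \<partial>K')" using test[OF f_cont f_lim] by simp
    moreover have "measure (V k) {t..} \<le> (\<integral>y. f y \<partial>R k) \<and> (\<integral>y. f y \<partial>R k) \<le> measure (V k) {s..}" for k
      using sand[OF sets_clipped_mu finite_R, of k] st by (simp add: V_tail(1))
    moreover have "T t \<le> (\<integral>y. f y \<partial>K')" "(\<integral>y. f y \<partial>K') \<le> T s"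
      using sand[OF K' finK'] st Dtail(3) by (auto simp: T_def)
    ultimately show ?thesis by blast
  qed
  have conv: "(\<lambda>k. enn2real (jump_tail k x)) \<longlonglongrightarrow> T x" if x: "0 < x" and cont: "isCont T x" for x
  proof (rule antimono_squeeze[OF _ _ x cont])
    fix s e :: real assume s: "0 < s" "s < x" "e > 0"
    from ramp[OF s(1,2)] obtain c I where cI: "I \<longlonglongrightarrow> c" "\<And>k. measure (V k) {x..} \<le> I k" "c \<le> T s" by auto
    have "0 < levy_wt x" "0 \<le> B" using x by (auto simp: levy_wt_pos B_def)
    then have "\<forall>\<^sub>F k in sequentially. h k < e * x * levy_wt x / (2 * (B + 1))"
      using s x by (intro h_small) auto
    moreover have "\<forall>\<^sub>F k in sequentially. I k < c + e / 2"
      using s by (intro order_tendstoD(2)[OF cI(1)]) auto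
    ultimately show "\<forall>\<^sub>F k in sequentially. enn2real (jump_tail k x) < T s + e"
      using mass
    proof eventually_elim
      case (elim k)
      have "enn2real (jump_tail k x) \<le> (1 + h k / x) * measure (V k) {x + h k..}"
        by (rule jump_tail_bounds(3)[OF x])
      also have "\<dots> \<le> (1 + h k / x) * measure (V k) {x..}"
        using x h_pos[of k] by (intro mult_left_mono V_antimono) (auto intro: add_nonneg_nonneg)
      also have "\<dots> = measure (V k) {x..} + h k / x * measure (V k) {x..}" by (simp add: algebra_simps)
      also have "h k / x * measure (V k) {x..} \<le> h k / x * (B / levy_wt x)"
      proof (rule mult_left_mono)
        have "measure (V k) {x..} \<le> measure (R k) UNIV / levy_wt x" by (rule V_tail(3)[OF x])
        also have "\<dots> \<le> B / levy_wt x" using elim \<open>0 < levy_wt x\<close> by (simp add: divide_right_mono)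
        finally show "measure (V k) {x..} \<le> B / levy_wt x" .
      qed (use x h_pos[of k] in auto)
      also have "h k / x * (B / levy_wt x) \<le> h k / x * ((B + 1) / levy_wt x)"
        using x h_pos[of k] \<open>0 < levy_wt x\<close> by (intro mult_left_mono divide_right_mono) auto
      also have "h k / x * ((B + 1) / levy_wt x) < e / 2"
        using elim(1) x \<open>0 < levy_wt x\<close> \<open>0 \<le> B\<close> by (simp add: field_simps)
      finally show ?case using cI(2)[of k] cI(3) elim(2) by linarith
    qed
  next
    fix t e :: real assume t: "x < t" "e > 0"
    define x' where "x' = (x + t) / 2"
    have x': "0 < x'" "x < x'" "x' < t" using x t by (auto simp: x'_def)
    from ramp[OF x'(1,3)] obtain c I where cI: "I \<longlonglongrightarrow> c" "\<And>k. I k \<le> measure (V k) {x'..}" "T t \<le> c" by auto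
    have "\<forall>\<^sub>F k in sequentially. c - e < I k"
      using t by (intro order_tendstoD(1)[OF cI(1)]) auto
    moreover have "\<forall>\<^sub>F k in sequentially. h k < x' - x" using x' by (intro h_small) auto
    ultimately show "\<forall>\<^sub>F k in sequentially. T t - e < enn2real (jump_tail k x)"
    proof eventually_elim
      case (elim k)
      have "measure (V k) {x'..} \<le> measure (V k) {x + h k..}"
        using elim x h_pos[of k] by (intro V_antimono) auto
      also have "\<dots> \<le> enn2real (jump_tail k x)" by (rule jump_tail_bounds(2)[OF x])
      finally show ?case using elim(1) cI(2)[of k] cI(3) by linarith
    qed
  qed
  have "countable {x. 0 < x \<and> \<not> isCont T x}" using Tmono by (rule countable_discontinuities_antimono)
  then have "AE x in lborel. x \<notin> {x. 0 < x \<and> \<not> isCont T x}"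
      by (intro AE_not_in countable_imp_null_set_lborel)
  then have "AE x in lborel. x > 0 \<longrightarrow> (\<lambda>k. jump_tail k x) \<longlonglongrightarrow> emeasure F {x..}"
  proof (rule eventually_mono, intro impI)
    fix x :: real assume "x \<notin> {x. 0 < x \<and> \<not> isCont T x}" and x: "0 < x"
    then have "(\<lambda>k. enn2real (jump_tail k x)) \<longlonglongrightarrow> T x" by (intro conv) auto
    then have "(\<lambda>k. ennreal (enn2real (jump_tail k x))) \<longlonglongrightarrow> ennreal (T x)" by (rule tendsto_ennrealI)
    then show "(\<lambda>k. jump_tail k x) \<longlonglongrightarrow> emeasure F {x..}"
      by (simp only: F_tail[OF x] jump_tail_bounds(1)[OF x, symmetric])
  qed
  then show ?thesis using a b b0 setsF sig by blast
qed

end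

section \<open>From convergence of the jumps to Levy-convergence\<close>

lemma integrable_compact_support:
  fixes f :: "real \<Rightarrow> real" and M :: "real measure"
  assumes [measurable_cong, simp]: "sets M = sets borel"
    and fin: "emeasure M {\<alpha>..\<beta>} < \<infinity>"
    and f: "continuous_on UNIV f" and supp: "\<And>y. y \<notin> {\<alpha>..\<beta>} \<Longrightarrow> f y = 0"
  shows "integrable M f"
proof -
  have [measurable]: "f \<in> borel_measurable borel" using f by (rule borel_measurable_continuous_onI)
  have "bounded (f ` {\<alpha>..\<beta>})"
    by (intro compact_imp_bounded compact_continuous_image continuous_on_subset[OF f]) auto
  then obtain B where B: "\<And>y. y \<in> {\<alpha>..\<beta>} \<Longrightarrow> \<bar>f y\<bar> \<le> B" unfolding bounded_iff real_norm_def by blast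
  show ?thesis
  proof (rule Bochner_Integration.integrable_bound)
    show "integrable M (\<lambda>y. B * indicator {\<alpha>..\<beta>} y)"
      using fin by (intro integrable_mult_right integrable_real_indicator) auto
    show "AE y in M. norm (f y) \<le> norm (B * indicator {\<alpha>..\<beta>} y)"
    proof (rule AE_I2)
      fix y show "norm (f y) \<le> norm (B * indicator {\<alpha>..\<beta>} y)"
        using B[of y] supp[of y] by (cases "y \<in> {\<alpha>..\<beta>}") auto
    qed
  qed measurable
qed

text \<open>
Subtracting from \<open>H\<close> its truncation to \<open>[-d, d]\<close> gives a continuous function with compact support in
\<open>(0,\<infinity>)\<close> that differs from \<open>H\<close> by at most \<open>d\<close>, and the masses are bounded.
\<close>

lemma convergence_vanishing_at_ends:
  fixes M :: "nat \<Rightarrow> real measure" and N :: "real measure" and H :: "real \<Rightarrow> real"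
  assumes sets_M [measurable_cong, simp]:
      "\<And>k. sets (M k) = sets borel" and sets_N [measurable_cong, simp]: "sets N = sets borel"
    and finM: "\<And>k. finite_measure (M k)" and finN: "finite_measure N"
    and mass: "\<forall>\<^sub>F k in sequentially. measure (M k) UNIV \<le> B"
    and conv: "\<And>(f :: real \<Rightarrow> real) \<alpha> \<beta>. continuous_on UNIV f \<Longrightarrow> 0 < \<alpha> \<Longrightarrow> (\<And>y. y \<notin> {\<alpha>..\<beta>} \<Longrightarrow> f y = 0) \<Longrightarrow>
      (\<lambda>k. \<integral>y. f y \<partial>M k) \<longlonglongrightarrow> (\<integral>y. f y \<partial>N)"
    and H: "continuous_on UNIV H" "\<And>y. \<bar>H y\<bar> \<le> C" "\<And>y. y \<le> 0 \<Longrightarrow> H y = 0" "(H \<longlongrightarrow> 0) at_top"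
  shows "(\<lambda>k. \<integral>y. H y \<partial>M k) \<longlonglongrightarrow> (\<integral>y. H y \<partial>N)"
proof (rule LIMSEQ_I)
  fix e :: real assume e: "e > 0"
  define D where "D = max B (measure N UNIV) + 1"
  have D: "D > 0" "B \<le> D" "measure N UNIV \<le> D" unfolding D_def using measure_nonneg[of N UNIV] by linarith+
  define d where "d = e / (4 * D)"
  have d: "d > 0" using e D by (simp add: d_def)
  have [measurable]: "H \<in> borel_measurable borel" using H(1) by (rule borel_measurable_continuous_onI)
  define f where "f y = H y - max (- d) (min d (H y))" for y
  have f_cont: "continuous_on UNIV f" unfolding f_def using H(1) by (intro continuous_intros)
  then have [measurable]: "f \<in> borel_measurable borel" by (rule borel_measurable_continuous_onI)
  have close: "\<bar>H y - f y\<bar> \<le> d" for y using d by (simp add: f_def)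
  have f_zero: "f y = 0" if "\<bar>H y\<bar> \<le> d" for y
  proof -
    have "min d (H y) = H y" "max (- d) (H y) = H y" using that by auto
    then show ?thesis by (simp add: f_def)
  qed
  have fC: "\<bar>f y\<bar> \<le> C + d" for y using close[of y] H(2)[of y] by linarith
  have "isCont H 0" using H(1) by (simp add: continuous_on_eq_continuous_at)
  then obtain \<alpha> where al: "\<alpha> > 0" "\<And>y. \<bar>y - 0\<bar> < \<alpha> \<Longrightarrow> \<bar>H y - H 0\<bar> < d"
    using d unfolding continuous_at_eps_delta dist_real_def by blast
  obtain \<beta> where be: "\<And>y. \<beta> \<le> y \<Longrightarrow> \<bar>H y\<bar> < d"
    using tendstoD[OF H(4) d] by (auto simp: eventually_at_top_linorder)
  have supp: "f y = 0" if "y \<notin> {\<alpha>..\<beta>}" for y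
  proof (rule f_zero)
    consider "y \<le> 0" | "0 < y" "y < \<alpha>" | "\<beta> \<le> y" using \<open>y \<notin> {\<alpha>..\<beta>}\<close> by fastforce
    then show "\<bar>H y\<bar> \<le> d"
    proof cases
      case 1 then show ?thesis using H(3)[of y] d by simp
    next
      case 2 then show ?thesis using al(2)[of y] H(3)[of 0] by simp
    next
      case 3 then show ?thesis using be[of y] by simp
    qed
  qed
  have err: "\<bar>(\<integral>y. H y \<partial>P) - (\<integral>y. f y \<partial>P)\<bar> \<le> e / 4"
    if [measurable_cong, simp]: "sets P = sets borel"
        and "finite_measure P" and PD: "measure P UNIV \<le> D" for P :: "real measure"
  proof -
    interpret P: finite_measure P by fact
    have spP: "space P = UNIV" using sets_eq_imp_space_eq[of P borel] by simp
    have "integrable P H" using H(2) by (intro P.integrable_const_bound[where B = C]) auto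
    moreover have "integrable P f" using fC by (intro P.integrable_const_bound[where B = "C + d"]) auto
    ultimately have i: "integrable P H" "integrable P f" .
    have "\<bar>(\<integral>y. H y \<partial>P) - (\<integral>y. f y \<partial>P)\<bar> = \<bar>\<integral>y. H y - f y \<partial>P\<bar>" using i by simp
    also have "\<dots> \<le> (\<integral>y. \<bar>H y - f y\<bar> \<partial>P)" by (rule integral_abs_bound)
    also have "\<dots> \<le> (\<integral>y. d \<partial>P)" using i close by (intro integral_mono) auto
    also have "\<dots> = measure P UNIV * d" by (simp add: spP)
    also have "\<dots> \<le> D * d" using PD d by (intro mult_right_mono) auto
    also have "\<dots> = e / 4" using D by (simp add: d_def)
    finally show ?thesis .
  qed
  from conv[OF f_cont al(1) supp] have "(\<lambda>k. \<integral>y. f y \<partial>M k) \<longlonglongrightarrow> (\<integral>y. f y \<partial>N)" .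
  from LIMSEQ_D[OF this, of "e / 4"] e obtain k0 where k0:
      "\<And>k. k \<ge> k0 \<Longrightarrow> \<bar>(\<integral>y. f y \<partial>M k) - (\<integral>y. f y \<partial>N)\<bar> < e / 4" by auto
  from mass obtain k1 where k1: "\<And>k. k \<ge> k1 \<Longrightarrow> measure (M k) UNIV \<le> B"
      by (auto simp: eventually_sequentially)
  show "\<exists>no. \<forall>k\<ge>no. norm ((\<integral>y. H y \<partial>M k) - (\<integral>y. H y \<partial>N)) < e"
  proof (intro exI allI impI)
    fix k assume "k \<ge> max k0 k1"
    then have k: "k \<ge> k0" "k \<ge> k1" by auto
    have "measure (M k) UNIV \<le> D" using k1[OF k(2)] D by linarith
    from err[OF sets_M finM this] err[OF sets_N finN D(3)] k0[OF k(1)]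
    show "norm ((\<integral>y. H y \<partial>M k) - (\<integral>y. H y \<partial>N)) < e" using e unfolding real_norm_def by linarith
  qed
qed

text \<open>
Mass may escape to 0 or \<open>\<infinity>\<close>, but none is created: cutting \<open>\<psi>\<close> off to compact support lowers the
integrals along the sequence, and Fatou's lemma removes the cut-off in the limit measure. This
yields both the finiteness of the limit measure and the nonnegativity of the masses at the end
points.
\<close>

lemma compact_cutoff_bound:
  fixes M :: "nat \<Rightarrow> real measure" and N :: "real measure" and \<psi> :: "real \<Rightarrow> real"
  assumes sets_M [measurable_cong, simp]:
      "\<And>k. sets (M k) = sets borel" and sets_N [measurable_cong, simp]: "sets N = sets borel"
    and finM: "\<And>k. finite_measure (M k)" and posM: "\<And>k. AE y in M k. 0 < y"
    and posN: "AE y in N. 0 < y" and locN: "\<And>\<alpha> \<beta>. 0 < \<alpha> \<Longrightarrow> emeasure N {\<alpha>..\<beta>} < \<infinity>"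
    and conv: "\<And>(f :: real \<Rightarrow> real) \<alpha> \<beta>. continuous_on UNIV f \<Longrightarrow> 0 < \<alpha> \<Longrightarrow> (\<And>y. y \<notin> {\<alpha>..\<beta>} \<Longrightarrow> f y = 0) \<Longrightarrow>
      (\<lambda>k. \<integral>y. f y \<partial>M k) \<longlonglongrightarrow> (\<integral>y. f y \<partial>N)"
    and psi: "continuous_on UNIV \<psi>" "\<And>y. 0 \<le> y \<Longrightarrow> 0 \<le> \<psi> y" "\<And>y. 0 \<le> y \<Longrightarrow> \<psi> y \<le> C"
    and lim: "(\<lambda>k. \<integral>y. \<psi> y \<partial>M k) \<longlonglongrightarrow> L"
  shows "(\<integral>\<^sup>+y. ennreal (\<psi> y) \<partial>N) \<le> ennreal L"
proof -
  have [measurable]: "\<psi> \<in> borel_measurable borel" using psi(1) by (rule borel_measurable_continuous_onI)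
  \<comment> \<open>A trapezoid supported in \<open>[1/n, n]\<close> that increases to 1 on \<open>(0,\<infinity>)\<close>.\<close>
  define cut where "cut n y = max 0 (min 1 (min (real n * y - 1) (real n - y)))" for n :: nat and y :: real
  have cut: "0 \<le> cut n y" "cut n y \<le> 1" for n y by (auto simp: cut_def)
  have cut_cont: "continuous_on UNIV (\<lambda>y. \<psi> y * cut n y)" for n
    unfolding cut_def using psi(1) by (intro continuous_intros)
  have [measurable]: "cut n \<in> borel_measurable borel" for n
    unfolding cut_def [abs_def] by measurable
  \<comment> \<open>The support is contained in \<open>[1/n, n]\<close>; the weaker left end \<open>1/(n+1)\<close> is also positive for \<open>n = 0\<close>.\<close>
  have supp: "\<psi> y * cut n y = 0" if "y \<notin> {1 / real (Suc n)..real n}" for y n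
  proof -
    have "y < 1 / real (Suc n) \<or> real n < y" using that by auto
    then consider "y < 0" | "0 \<le> y" "y < 1 / real (Suc n)" | "real n < y" by linarith
    then have "real n * y - 1 \<le> 0 \<or> real n - y \<le> 0"
    proof cases
      case 1
      then show ?thesis using mult_nonneg_nonpos[of "real n" y] by auto
    next
      case 2
      then have "real (Suc n) * y < 1" by (simp add: field_simps)
      moreover have "real n * y \<le> real (Suc n) * y" using 2 by (intro mult_right_mono) auto
      ultimately show ?thesis by linarith
    qed auto
    then show ?thesis by (auto simp: cut_def max_def min_def)
  qed
  have bound: "(\<integral>\<^sup>+y. ennreal (\<psi> y * cut n y) \<partial>N) \<le> ennreal L" for n
  proof -
    have "(\<lambda>k. \<integral>y. \<psi> y * cut n y \<partial>M k) \<longlonglongrightarrow> (\<integral>y. \<psi> y * cut n y \<partial>N)"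
      by (rule conv[OF cut_cont _ supp]) auto
    moreover have "(\<integral>y. \<psi> y * cut n y \<partial>M k) \<le> (\<integral>y. \<psi> y \<partial>M k)" for k
    proof -
      interpret finite_measure "M k" by (rule finM)
      have le: "0 \<le> \<psi> y * cut n y" "\<psi> y * cut n y \<le> \<psi> y" if "0 \<le> y" for y
        using psi(2)[OF that] cut[of n y] by (auto simp: mult_left_le)
      have "integrable (M k) \<psi>"
        using posM[of k] psi by (intro integrable_const_bound[where B = C]) (auto elim!: eventually_mono)
      moreover have "\<bar>\<psi> y * cut n y\<bar> \<le> C" if "0 < y" for y
        using le[of y] psi(3)[of y] that by auto
      then have "integrable (M k) (\<lambda>y. \<psi> y * cut n y)"
        using posM[of k] by (intro integrable_const_bound[where B = C]) (auto elim!: eventually_mono)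
      ultimately show ?thesis using posM[of k] le by (intro integral_mono_AE) (auto elim!: eventually_mono)
    qed
    ultimately have "(\<integral>y. \<psi> y * cut n y \<partial>N) \<le> L" using lim by (intro LIMSEQ_le) auto
    moreover have "integrable N (\<lambda>y. \<psi> y * cut n y)"
      by (rule integrable_compact_support[OF sets_N locN cut_cont supp]) auto
    then have "(\<integral>\<^sup>+y. ennreal (\<psi> y * cut n y) \<partial>N) = ennreal (\<integral>y. \<psi> y * cut n y \<partial>N)"
      using posN psi(2) cut by (intro nn_integral_eq_integral) (auto elim!: eventually_mono)
    ultimately show ?thesis by (simp add: ennreal_leI)
  qed
  have "(\<integral>\<^sup>+y. ennreal (\<psi> y) \<partial>N) \<le> liminf (\<lambda>n. \<integral>\<^sup>+y. ennreal (\<psi> y * cut n y) \<partial>N)"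
  proof -
    have "AE y in N. ennreal (\<psi> y) = liminf (\<lambda>n. ennreal (\<psi> y * cut n y))"
      using posN
    proof eventually_elim
      case (elim y)
      obtain m :: nat where m: "2 / y + y + 1 < real m" using reals_Archimedean2 by blast
      have "cut n y = 1" if "n \<ge> m" for n
      proof -
        have n: "2 / y + y + 1 < real n" using m that by linarith
        have "2 / y < real n" using n elim by linarith
        then have "2 < real n * y" using elim by (simp add: pos_divide_less_eq)
        moreover have "1 < real n - y"
        proof -
          have "0 < 2 / y" using elim by simp
          then show ?thesis using n by linarith
        qed
        ultimately show ?thesis by (simp add: cut_def)
      qed
      then have "\<forall>\<^sub>F n in sequentially. ennreal (\<psi> y) = ennreal (\<psi> y * cut n y)"
        unfolding eventually_sequentially by (intro exI[of _ m]) simp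
      then have "(\<lambda>n. ennreal (\<psi> y * cut n y)) \<longlonglongrightarrow> ennreal (\<psi> y)"
        by (rule Lim_transform_eventually[OF tendsto_const])
      then show ?case by (simp add: lim_imp_Liminf)
    qed
    then have "(\<integral>\<^sup>+y. ennreal (\<psi> y) \<partial>N) = (\<integral>\<^sup>+y. liminf (\<lambda>n. ennreal (\<psi> y * cut n y)) \<partial>N)"
      by (rule nn_integral_cong_AE)
    also have "\<dots> \<le> liminf (\<lambda>n. \<integral>\<^sup>+y. ennreal (\<psi> y * cut n y) \<partial>N)"
      by (rule nn_integral_liminf) measurable
    finally show ?thesis .
  qed
  also have "\<dots> \<le> ennreal L"
    by (intro Liminf_le always_eventually allI bound) simp
  finally show ?thesis .
qed

context rescaled_offspring
begin

text \<open>
The two moment conditions bound the masses of \<open>R k\<close>, and the tail condition says that \<open>R k\<close>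
converges on compact subsets of \<open>(0,\<infinity>)\<close> to the measure \<open>N\<close> with density \<open>levy_wt\<close> with respect to
\<open>F\<close>. What the two kernels lose in the limit is the mass that escapes to the end points:
\<open>kernel_zero\<close> is 1 at 0 and 0 at \<open>\<infinity>\<close>, and \<open>kernel_inf\<close> the other way round, so
\<open>b - \<integral> kernel_zero dN\<close> is the mass at 0 and \<open>- a - \<integral> kernel_inf dN\<close> that at \<open>\<infinity>\<close>. Subtracting from a
test function the combination of the kernels with the same end values leaves a function that
vanishes at both ends.
\<close>

lemma levy_from_jump_conditions:
  assumes setsF: "sets F = sets (restrict_space borel {0<..})"
    and a: "(\<lambda>k. (\<integral>x. x / (1 + x\<^sup>2) \<partial>eta (p k) (h k)) / (h k * \<tau> k)) \<longlonglongrightarrow> a"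
    and b: "(\<lambda>k. (\<integral>x. x\<^sup>2 / (1 + x\<^sup>2) \<partial>eta (p k) (h k)) / (h k * \<tau> k)) \<longlonglongrightarrow> b"
    and tails: "AE x in lborel. x > 0 \<longrightarrow> (\<lambda>k. jump_tail k x) \<longlonglongrightarrow> emeasure F {x..}"
  shows "\<exists>K::ennreal measure. sets K = sets borel \<and> finite_measure K \<and>
        levy_converges (\<lambda>k. mu_breve (p k) (h k) (\<tau> k)) K"
proof -
  have a': "(\<lambda>k. \<integral>y. kernel_inf (h k) y \<partial>R k) \<longlonglongrightarrow> - a"
    using tendsto_minus[OF a] by (simp add: integral_eta_kernel(1)[OF mean_one h_pos tau_pos])
  have b': "(\<lambda>k. \<integral>y. kernel_zero (h k) y \<partial>R k) \<longlonglongrightarrow> b"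
    using b by (simp add: integral_eta_kernel(2)[OF mean_one h_pos tau_pos])
  have ker_int: "integrable (R k) (kernel_inf (h k)) \<and> integrable (R k) (kernel_zero (h k))"
      if "h k < 1" for k
    by (intro conjI integrable_kernel(2)) (use that kernel_close kernel_bounds_abs in auto)
  define B where "B = max 0 (8 * (b - a + 1))"
  have mass: "\<forall>\<^sub>F k in sequentially. measure (R k) UNIV \<le> B"
  proof -
    have "\<forall>\<^sub>F k in sequentially. (\<integral>y. kernel_inf (h k) y \<partial>R k) + (\<integral>y. kernel_zero (h k) y \<partial>R k) < - a
        + b + 1"
      by (rule order_tendstoD(2)[OF tendsto_add[OF a' b']]) simp
    moreover have "\<forall>\<^sub>F k in sequentially. h k < 1 / 2" by (rule h_small) simp
    ultimately show ?thesis
    proof eventually_elim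
      case (elim k)
      interpret finite_measure "R k" by (rule finite_R)
      have "measure (R k) UNIV / 8 = (\<integral>y. 1 / 8 \<partial>R k)" by simp
      also have "\<dots> \<le> (\<integral>y. kernel_inf (h k) y + kernel_zero (h k) y \<partial>R k)"
      proof (rule integral_mono_AE)
        show "AE y in R k. 1 / 8 \<le> kernel_inf (h k) y + kernel_zero (h k) y"
          using AE_R(1)[of k]
        proof (rule eventually_mono)
          fix y assume "2 * h k \<le> y"
          then show "1 / 8 \<le> kernel_inf (h k) y + kernel_zero (h k) y"
            using elim h_pos[of k] by (intro kernel_sum_ge) auto
        qed
      qed (use ker_int[of k] elim in auto)
      also have "\<dots> = (\<integral>y. kernel_inf (h k) y \<partial>R k) + (\<integral>y. kernel_zero (h k) y \<partial>R k)"
        using ker_int[of k] elim by simp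
      also have "\<dots> < - a + b + 1" by (rule elim(1))
      finally have "measure (R k) UNIV \<le> 8 * (b - a + 1)" by simp
      then show ?case by (simp add: B_def)
    qed
  qed
  have a0: "(\<lambda>k. \<integral>y. kernel_inf 0 y \<partial>R k) \<longlonglongrightarrow> - a"
    using tendsto_diff[OF a' kernel_inf_limit[OF mass]] by simp
  have b0: "(\<lambda>k. \<integral>y. kernel_zero 0 y \<partial>R k) \<longlonglongrightarrow> b"
    using tendsto_diff[OF b' kernel_zero_limit[OF mass]] by simp
  \<comment> \<open>Almost every point is a point of convergence, hence such points are dense.\<close>
  have dense: "\<exists>x. s < x \<and> x < t \<and> (\<lambda>k. jump_tail k x) \<longlonglongrightarrow> emeasure F {x..}" if "0 \<le> s" "s < t"
      for s t :: real
  proof (rule ccontr)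
    assume no: "\<not> ?thesis"
    have "AE x in lborel. x \<notin> {s<..<t}" using tails
      by (rule eventually_mono) (use no that in force)
    then have "emeasure lborel {s<..<t} = 0"
        by (subst (asm) AE_iff_null_sets[symmetric]) (auto simp: null_sets_def)
    then show False using that by (simp add: ennreal_eq_0_iff)
  qed
  define F0 where "F0 = distr F borel (\<lambda>x. x)"
  have idF: "(\<lambda>x. x) \<in> borel_measurable F"
    using measurable_restrict_space1[OF measurable_ident] setsF
        by (simp cong: measurable_cong_sets add: id_def)
  have [measurable_cong, simp]: "sets F0 = sets borel" by (simp add: F0_def)
  have spF: "space F = {0<..}" using sets_eq_imp_space_eq[OF setsF] by (simp add: space_restrict_space)
  have posF0: "AE y in F0. 0 < y" unfolding F0_def
    by (subst AE_distr_iff) (auto simp: spF idF)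
  have F0_tail: "emeasure F0 {x..} = emeasure F {x..}" if "0 < x" for x
  proof -
    have "(\<lambda>x. x) -` {x..} \<inter> space F = {x..}" using that by (auto simp: spF)
    then show ?thesis by (simp add: F0_def emeasure_distr idF)
  qed
  have F0_fin: "emeasure F0 {x..} < \<infinity>" if x: "0 < x" for x
  proof -
    obtain y where y: "x / 2 < y" "y < x" "(\<lambda>k. jump_tail k y) \<longlonglongrightarrow> emeasure F {y..}"
        using dense[of "x / 2" x] x by auto
    have y0: "0 < y" using x y by linarith
    have "\<forall>\<^sub>F k in sequentially. h k < y" using y0 by (rule h_small)
    with mass have "\<forall>\<^sub>F k in sequentially. jump_tail k y \<le> ennreal (2 * (B / levy_wt y))"
    proof eventually_elim
      case (elim k)
      have "enn2real (jump_tail k y) \<le> (1 + h k / y) * measure (V k) {y + h k..}"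
          by (rule jump_tail_bounds(3)[OF y0])
      also have "\<dots> \<le> 2 * (B / levy_wt y)"
      proof (rule mult_mono)
        show "1 + h k / y \<le> 2" using elim y0 by simp
        have "measure (V k) {y + h k..} \<le> measure (V k) {y..}" using y0 h_pos[of k]
            by (intro V_antimono) auto
        also have "\<dots> \<le> measure (R k) UNIV / levy_wt y" by (rule V_tail(3)[OF y0])
        also have "\<dots> \<le> B / levy_wt y" using elim levy_wt_pos[OF y0] by (intro divide_right_mono) auto
        finally show "measure (V k) {y + h k..} \<le> B / levy_wt y" .
      qed auto
      finally show ?case by (subst jump_tail_bounds(1)[OF y0]) (rule ennreal_leI)
    qed
    then have "emeasure F {y..} \<le> ennreal (2 * (B / levy_wt y))"
      by (intro tendsto_upperbound[OF y(3)]) auto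
    also have "\<dots> < \<infinity>" by simp
    finally have "emeasure F0 {y..} < \<infinity>" using F0_tail[OF y0] by simp
    moreover have "emeasure F0 {x..} \<le> emeasure F0 {y..}" using y by (intro emeasure_mono) auto
    ultimately show ?thesis by (rule le_less_trans[rotated])
  qed
  define T where "T x = measure F0 {x..}" for x
  have T: "emeasure F0 {x..} = ennreal (T x)" if "0 < x" for x
    using F0_fin[OF that] unfolding T_def by (intro emeasure_eq_ennreal_measure) auto
  have Tmono: "T y \<le> T x" if "0 < x" "x \<le> y" for x y
  proof -
    have "emeasure F0 {y..} \<le> emeasure F0 {x..}" using that by (intro emeasure_mono) auto
    then show ?thesis using that by (simp add: T T_def ennreal_le_iff)
  qed
  have dense': "\<exists>x. s < x \<and> x < t \<and> (\<lambda>k. enn2real (jump_tail k x)) \<longlonglongrightarrow> T x" if st: "0 \<le> s" "s < t"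
      for s t :: real
  proof -
    obtain x where x: "s < x" "x < t" "(\<lambda>k. jump_tail k x) \<longlonglongrightarrow> emeasure F {x..}" using dense[OF st] by auto
    then have x0: "0 < x" using st by linarith
    then have "emeasure F {x..} = ennreal (T x)" using F0_tail[OF x0] T[OF x0] by simp
    then have "(\<lambda>k. enn2real (jump_tail k x)) \<longlonglongrightarrow> T x"
      using x(3) by (intro tendsto_enn2real) (auto simp: T_def)
    then show ?thesis using x by blast
  qed
  have Vconv: "(\<lambda>k. measure (V k) {x..}) \<longlonglongrightarrow> measure F0 {x..}" if x: "0 < x" and cont: "isCont T x" for x
    unfolding T_def[symmetric]
  proof (rule antimono_squeeze[OF _ _ x cont])
    fix s e :: real assume s: "0 < s" "s < x" "e > 0"
    obtain s' where s': "s < s'" "s' < x" "(\<lambda>k. enn2real (jump_tail k s')) \<longlonglongrightarrow> T s'"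
        using dense'[of s x] s by auto
    have "\<forall>\<^sub>F k in sequentially. enn2real (jump_tail k s') < T s' + e" using s
        by (intro order_tendstoD(2)[OF s'(3)]) auto
    moreover have "\<forall>\<^sub>F k in sequentially. h k < x - s'" using s' by (intro h_small) auto
    ultimately show "\<forall>\<^sub>F k in sequentially. measure (V k) {x..} < T s + e"
    proof eventually_elim
      case (elim k)
      have "measure (V k) {x..} \<le> measure (V k) {s' + h k..}" using elim s s' h_pos[of k]
          by (intro V_antimono) auto
      also have "\<dots> \<le> enn2real (jump_tail k s')" using s s' by (intro jump_tail_bounds(2)) auto
      finally show ?case using elim(1) Tmono[of s s'] s s' by linarith
    qed
  next
    fix t e :: real assume t: "x < t" "e > 0"
    obtain t' where t': "x < t'" "t' < t" "(\<lambda>k. enn2real (jump_tail k t')) \<longlonglongrightarrow> T t'"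
        using dense'[of x t] t x by auto
    have t0: "0 < t'" using t' x by linarith
    have "(\<lambda>k. enn2real (jump_tail k t') / (1 + h k / t')) \<longlonglongrightarrow> T t' / (1 + 0 / t')"
      using t0 by (intro tendsto_intros t'(3) h_lim) auto
    then have "\<forall>\<^sub>F k in sequentially. T t' - e < enn2real (jump_tail k t') / (1 + h k / t')"
      using t by (intro order_tendstoD(1)) auto
    then show "\<forall>\<^sub>F k in sequentially. T t - e < measure (V k) {x..}"
    proof eventually_elim
      case (elim k)
      have "0 < 1 + h k / t'" using t0 h_pos[of k] by (auto intro: add_pos_nonneg)
      then have "enn2real (jump_tail k t') / (1 + h k / t') \<le> measure (V k) {t' + h k..}"
        using jump_tail_bounds(3)[OF t0, of k] by (simp add: pos_divide_le_eq mult.commute)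
      also have "\<dots> \<le> measure (V k) {x..}" using x t' h_pos[of k] by (intro V_antimono) auto
      finally show ?case using elim Tmono[of t' t] t0 t' by linarith
    qed
  qed
  have vague: "(\<lambda>k. \<integral>y. u y \<partial>V k) \<longlonglongrightarrow> (\<integral>y. u y \<partial>F0)"
    if u: "continuous_on UNIV u" and "0 < \<alpha>" "\<And>y. y \<notin> {\<alpha>..\<beta>} \<Longrightarrow> u y = 0" for u :: "real \<Rightarrow> real" and \<alpha> \<beta>
  proof (rule vague_convergence_from_tails[where N = "{x. 0 < x \<and> \<not> isCont T x}"])
    show "countable {x. 0 < x \<and> \<not> isCont T x}" using Tmono by (rule countable_discontinuities_antimono)
    show "emeasure (V k) {x..} < \<infinity>" if "0 < x" for k x using that by (simp add: V_tail(2))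
  qed (use that F0_fin Vconv in \<open>auto simp: jump_mu_def\<close>)
  define N where "N = density F0 (\<lambda>y. ennreal (levy_wt y))"
  have [measurable_cong, simp]: "sets N = sets borel" by (simp add: N_def)
  have posN: "AE y in N. 0 < y" unfolding N_def using posF0
    by (subst AE_density) (auto elim!: eventually_mono)
  have unit_cont: "continuous_on UNIV levy_wt" unfolding levy_wt_def [abs_def] by (intro continuous_intros)
  have conv: "(\<lambda>k. \<integral>y. f y \<partial>R k) \<longlonglongrightarrow> (\<integral>y. f y \<partial>N)"
    if f: "continuous_on UNIV f" and al: "0 < \<alpha>" and supp: "\<And>y. y \<notin> {\<alpha>..\<beta>} \<Longrightarrow> f y = 0"
        for f :: "real \<Rightarrow> real" and \<alpha> \<beta>
  proof -
    have [measurable]: "f \<in> borel_measurable borel" using f by (rule borel_measurable_continuous_onI)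
    have "(\<lambda>k. \<integral>y. levy_wt y * f y \<partial>V k) \<longlonglongrightarrow> (\<integral>y. levy_wt y * f y \<partial>F0)"
      by (rule vague[where \<beta> = \<beta>, OF continuous_on_mult[OF unit_cont f] al]) (use supp in simp)
    moreover have "(\<integral>y. levy_wt y * f y \<partial>F0) = (\<integral>y. f y \<partial>N)"
      unfolding N_def using posF0 levy_wt_pos
          by (subst integral_density) (auto elim!: eventually_mono intro: less_imp_le)
    moreover have "(\<integral>y. levy_wt y * f y \<partial>V k) = (\<integral>y. f y \<partial>R k)" for k
    proof -
      have "AE y in R k. 0 \<le> 1 / levy_wt y" using AE_R(2)[of k]
          by (rule eventually_mono) (simp add: levy_wt_pos less_imp_le)
      then have "(\<integral>y. levy_wt y * f y \<partial>V k) = (\<integral>y. 1 / levy_wt y * (levy_wt y * f y) \<partial>R k)"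
        unfolding jump_mu_def by (subst integral_density) auto
      also have "\<dots> = (\<integral>y. f y \<partial>R k)"
      proof (rule integral_cong_AE)
        show "AE y in R k. 1 / levy_wt y * (levy_wt y * f y) = f y" using AE_R(2)[of k]
        proof eventually_elim
          case (elim y)
          then show ?case using levy_wt_pos[of y] by simp
        qed
      qed measurable
      finally show ?thesis .
    qed
    ultimately show ?thesis by simp
  qed
  have locN: "emeasure N {\<alpha>..\<beta>} < \<infinity>" if "0 < \<alpha>" for \<alpha> \<beta>
  proof -
    have "emeasure N {\<alpha>..\<beta>} = (\<integral>\<^sup>+y. ennreal (levy_wt y) * indicator {\<alpha>..\<beta>} y \<partial>F0)"
      by (simp add: N_def emeasure_density)
    also have "\<dots> \<le> (\<integral>\<^sup>+y. ennreal (levy_wt \<beta>) * indicator {\<alpha>..} y \<partial>F0)"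
      using that by (intro nn_integral_mono) (auto simp: indicator_def intro!: ennreal_leI levy_wt_mono)
    also have "\<dots> = ennreal (levy_wt \<beta>) * emeasure F0 {\<alpha>..}" by (simp add: nn_integral_cmult)
    also have "\<dots> < \<infinity>" using F0_fin[OF that] by (simp add: ennreal_mult_less_top)
    finally show ?thesis .
  qed
  have cut: "(\<integral>\<^sup>+y. ennreal (\<psi> y) \<partial>N) \<le> ennreal L"
    if "continuous_on UNIV \<psi>" "\<And>y. 0 \<le> y \<Longrightarrow> 0 \<le> \<psi> y" "\<And>y. 0 \<le> y \<Longrightarrow> \<psi> y \<le> C"
      "(\<lambda>k. \<integral>y. \<psi> y \<partial>R k) \<longlonglongrightarrow> L" for \<psi> C L
    by (rule compact_cutoff_bound[where M = R])
       (fact sets_clipped_mu \<open>sets N = sets borel\<close> finite_R AE_R(2) posN locN conv that)+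
  have inf_le: "(\<integral>\<^sup>+y. ennreal (kernel_inf 0 y) \<partial>N) \<le> ennreal (- a)"
    by (rule cut[OF kernel_limit_continuous(1) _ _ a0, where C
        = 2]) (use kernel_bounded kernel_bounds_abs in \<open>auto simp: abs_le_iff\<close>)
  have zero_le: "(\<integral>\<^sup>+y. ennreal (kernel_zero 0 y) \<partial>N) \<le> ennreal b"
    by (rule cut[OF kernel_limit_continuous(2) _ _ b0, where C = 2]) (use kernel_bounded in auto)
  have finN: "finite_measure N"
  proof
    have "ennreal (1 / 2) * emeasure N (space N) = (\<integral>\<^sup>+y. ennreal (1 / 2) \<partial>N)" by simp
    also have "\<dots> \<le> (\<integral>\<^sup>+y. ennreal (kernel_inf 0 y) + ennreal (kernel_zero 0 y) \<partial>N)"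
      using posN
    proof (intro nn_integral_mono_AE, eventually_elim)
      case (elim y)
      then have "ennreal (1 / 2) \<le> ennreal (kernel_inf 0 y + kernel_zero 0 y)"
        using kernel_bounded[of y] by (intro ennreal_leI) auto
      then show ?case using kernel_bounded[of y] elim by (simp only: ennreal_plus less_imp_le)
    qed
    also have "\<dots> = (\<integral>\<^sup>+y. ennreal (kernel_inf 0 y) \<partial>N) + (\<integral>\<^sup>+y. ennreal (kernel_zero 0 y) \<partial>N)"
      by (rule nn_integral_add) auto
    also have "\<dots> \<le> ennreal (- a) + ennreal b" by (intro add_mono inf_le zero_le)
    also have "\<dots> < \<infinity>" by simp
    finally show "emeasure N (space N) \<noteq> \<infinity>" by (auto simp: ennreal_mult_less_top)
  qed
  then interpret N: finite_measure N .
  have int_N: "integrable N (kernel_inf 0)" "integrable N (kernel_zero 0)"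
    using posN kernel_bounds_abs
        by (auto intro!: N.integrable_const_bound[where B = 2] elim!: eventually_mono)
  have limits_nonneg: "0 \<le> - a" "0 \<le> b"
  proof -
    have "0 \<le> (\<integral>y. kernel_inf 0 y \<partial>R k)" "0 \<le> (\<integral>y. kernel_zero 0 y \<partial>R k)" for k
      using AE_R(2)[of k] kernel_bounded by (auto intro!: integral_nonneg_AE elim!: eventually_mono)
    then show "0 \<le> - a" "0 \<le> b"
        by (blast intro: LIMSEQ_le_const[OF a0], blast intro: LIMSEQ_le_const[OF b0])
  qed
  define \<alpha> where "\<alpha> = b - (\<integral>y. kernel_zero 0 y \<partial>N)"
  define \<beta> where "\<beta> = - a - (\<integral>y. kernel_inf 0 y \<partial>N)"
  have atoms: "0 \<le> \<alpha>" "0 \<le> \<beta>"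
  proof -
    have "AE y in N. 0 \<le> kernel_inf 0 y" "AE y in N. 0 \<le> kernel_zero 0 y"
      using posN kernel_bounded by (auto elim!: eventually_mono)
    then have "ennreal (\<integral>y. kernel_inf 0 y \<partial>N) \<le> ennreal (- a)" "ennreal (\<integral>y. kernel_zero 0 y \<partial>N)
        \<le> ennreal b"
      using inf_le zero_le by (simp_all add: nn_integral_eq_integral int_N)
    then show "0 \<le> \<alpha>" "0 \<le> \<beta>" using limits_nonneg by (simp_all add: \<alpha>_def \<beta>_def ennreal_le_iff)
  qed
  obtain K :: "ennreal measure" where K: "sets K = sets borel" "finite_measure K"
    "\<And>g :: ennreal \<Rightarrow> real. continuous_on UNIV g \<Longrightarrow>
       (\<integral>z. g z \<partial>K) = (\<integral>y. g (ennreal y) \<partial>N) + \<alpha> * g 0 + \<beta> * g \<infinity>"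
    using measure_with_atoms_at_endpoints[OF \<open>sets N = sets borel\<close> finN atoms] by blast
  have "levy_converges (\<lambda>k. mu_breve (p k) (h k) (\<tau> k)) K"
    unfolding levy_converges_def
  proof (intro allI impI)
    fix g :: "ennreal \<Rightarrow> real" assume g: "continuous_on UNIV g"
    have gm [measurable]: "g \<in> borel_measurable borel" using g by (rule borel_measurable_continuous_onI)
    have "bounded (range g)" by (intro compact_imp_bounded compact_continuous_image g compact_UNIV)
    then obtain C where C: "\<And>z. \<bar>g z\<bar> \<le> C" unfolding bounded_iff real_norm_def by blast
    \<comment> \<open>The maximum makes \<open>H\<close> vanish on the negative half-line.\<close>
    define H where "H y = g (ennreal y) - g 0 * kernel_zero 0 (max y 0) - g \<infinity> * kernel_inf 0 (max y 0)"
        for y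
    have maxc: "continuous_on UNIV (\<lambda>y. kernel_inf 0 (max y 0))" "continuous_on UNIV (\<lambda>y. kernel_zero 0
        (max y 0))"
      by (auto intro!: continuous_on_compose2[OF kernel_limit_continuous(1)] continuous_on_compose2[OF
          kernel_limit_continuous(2)] continuous_intros)
    have H_cont: "continuous_on UNIV H" unfolding H_def
      by (intro continuous_intros continuous_ennreal_real(1)[OF g] maxc)
    have H_bd: "\<bar>H y\<bar> \<le> 5 * C" for y
    proof -
      have "\<bar>g 0 * kernel_zero 0 (max y 0)\<bar> \<le> C * 2" "\<bar>g \<infinity> * kernel_inf 0 (max y 0)\<bar> \<le> C * 2"
        unfolding abs_mult using C[of 0] C[of \<infinity>] kernel_bounds_abs[of "max y 0"] by (auto intro!: mult_mono)
      then show ?thesis unfolding H_def using C[of "ennreal y"] by linarith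
    qed
    have H0: "H y = 0" if "y \<le> 0" for y
      using that by (simp add: H_def ennreal_neg max_absorb2 kernel_limits)
    have H_top: "(H \<longlongrightarrow> 0) at_top"
    proof -
      have "((\<lambda>y. g (ennreal y) - g 0 * kernel_zero 0 y - g \<infinity> * kernel_inf 0 y) \<longlongrightarrow> g \<infinity> - g 0 * 0 - g \<infinity>
          * 1) at_top"
        by (intro tendsto_intros continuous_ennreal_real(2)[OF g] kernel_limits)
      moreover have "\<forall>\<^sub>F y in at_top. g (ennreal y) - g 0 * kernel_zero 0 y - g \<infinity> * kernel_inf 0 y = H y"
        by (rule eventually_at_top_linorderI[of 0]) (simp add: H_def)
      ultimately show ?thesis using Lim_transform_eventually by fastforce
    qed
    have HK: "(\<lambda>k. \<integral>y. H y \<partial>R k) \<longlonglongrightarrow> (\<integral>y. H y \<partial>N)"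
      by (rule convergence_vanishing_at_ends)
         (fact sets_clipped_mu \<open>sets N = sets borel\<close> finite_R finN mass conv H_cont H_bd H0 H_top)+
    have split: "(\<integral>y. g (ennreal y) \<partial>P)
        = (\<integral>y. H y \<partial>P) + g 0 * (\<integral>y. kernel_zero 0 y \<partial>P) + g \<infinity> * (\<integral>y. kernel_inf 0 y \<partial>P)"
      if [measurable_cong, simp]: "sets P = sets borel"
          and "finite_measure P" and pos: "AE y in P. 0 < y" for P :: "real measure"
    proof -
      interpret P: finite_measure P by fact
      have [measurable]: "H \<in> borel_measurable borel" using H_cont by (rule borel_measurable_continuous_onI)
      have i: "integrable P H" "integrable P (kernel_inf 0)" "integrable P (kernel_zero 0)"
      proof -
        show "integrable P H" using H_bd by (intro P.integrable_const_bound[where B = "5 * C"]) auto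
        show "integrable P (kernel_inf 0)" "integrable P (kernel_zero 0)" using kernel_bounds_abs pos
          by (auto intro!: P.integrable_const_bound[where B = 2] elim!: eventually_mono)
      qed
      have "(\<integral>y. g (ennreal y) \<partial>P) = (\<integral>y. H y + g 0 * kernel_zero 0 y + g \<infinity> * kernel_inf 0 y \<partial>P)"
        using pos by (intro integral_cong_AE) (auto elim!: eventually_mono simp: H_def)
      then show ?thesis using i by simp
    qed
    have "(\<lambda>k. (\<integral>y. H y \<partial>R k) + g 0 * (\<integral>y. kernel_zero 0 y \<partial>R k) + g \<infinity> * (\<integral>y. kernel_inf 0 y \<partial>R k))
      \<longlonglongrightarrow> (\<integral>y. H y \<partial>N) + g 0 * b + g \<infinity> * (- a)"
      by (intro tendsto_intros HK a0 b0)
    also have "(\<integral>y. H y \<partial>N) + g 0 * b + g \<infinity> * (- a) = (\<integral>z. g z \<partial>K)"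
      using split[OF \<open>sets N = sets borel\<close> finN posN] by (simp add: K(3)[OF g] \<alpha>_def \<beta>_def algebra_simps)
    finally show "(\<lambda>k. \<integral>x. g (ennreal x) * min x 1 \<partial>mu_breve (p k) (h k) (\<tau> k)) \<longlonglongrightarrow> (\<integral>z. g z \<partial>K)"
      by (simp add: integral_mu_breve[OF tau_pos h_pos] split[OF sets_clipped_mu finite_R AE_R(2)])
  qed
  with K show ?thesis by blast
qed

end

theorem proposition7p4:
  fixes p :: "nat \<Rightarrow> nat pmf" and h \<tau> :: "nat \<Rightarrow> real"
  assumes mean_one: "\<And>k. (\<lambda>j. real j * pmf (p k) j) sums 1"
    and h_pos: "\<And>k. h k > 0" and h_lim: "h \<longlonglongrightarrow> 0"
    and tau_pos: "\<And>k. \<tau> k > 0" and tau_lim: "\<tau> \<longlonglongrightarrow> 0"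
  shows
    "(\<exists>(a::real) (b::real) (F::real measure).
        b \<ge> 0 \<and> sets F = sets (restrict_space borel {0<..}) \<and> sigma_finite_measure F \<and>
        (\<lambda>k. (\<integral>x. x / (1 + x\<^sup>2) \<partial>eta (p k) (h k)) / (h k * \<tau> k)) \<longlonglongrightarrow> a \<and>
        (\<lambda>k. (\<integral>x. x\<^sup>2 / (1 + x\<^sup>2) \<partial>eta (p k) (h k)) / (h k * \<tau> k)) \<longlonglongrightarrow> b \<and>
        (AE x in lborel. x > 0 \<longrightarrow>
           (\<lambda>k. emeasure (eta (p k) (h k)) {x..} / ennreal (h k * \<tau> k)) \<longlonglongrightarrow> emeasure F {x..}))
     \<longleftrightarrow>
     (\<exists>K::ennreal measure. sets K = sets borel \<and> finite_measure K \<and>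
        levy_converges (\<lambda>k. mu_breve (p k) (h k) (\<tau> k)) K)"
proof -
  interpret rescaled_offspring p h \<tau>
    by standard (use assms in auto)
  show ?thesis
    using levy_from_jump_conditions jump_conditions_from_levy by blast
qed

end
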